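(* The Lie group $\mathrm{SL}(3,\mathbb{R})$ does not admit any left-invariant hypercomplex structure. Equivalently, there do not exist real linear endomorphisms $J_1,J_2,J_3$ of the Lie algebra $\mathfrak{sl}(3,\mathbb{R})$ with $J_\alpha^2=-\mathrm{Id}$ and $N_{J_\alpha}=0$ for $\alpha=1,2,3$, and $J_1J_2=-J_2J_1=J_3$.
   Context: For a real Lie algebra $\mathfrak g$ and a linear map $J:\mathfrak g\to\mathfrak g$ with $J^2=-\mathrm{Id}$, the Nijenhuis tensor is $N_J(x,y)=[x,y]+J([Jx,y]+[x,Jy])-[Jx,Jy]$; $J$ is a complex structure on $\mathfrak g$ if $N_J\equiv 0$. Left-invariant complex structures on a Lie group correspond to complex structures on its Lie algebra. A hypercomplex structure on $\mathfrak g$ (equivalently a left-invariant hypercomplex structure on the Lie group) is a triple $\{J_1,J_2,J_3\}$ of complex structures with $J_1J_2=-J_2J_1=J_3$. *)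

theory Defs
  imports "HOL-Analysis.Analysis"
begin

section \<open>Complex and hypercomplex structures on Lie algebras\<close>

text \<open>
  A Lie algebra is given by a carrier subspace \<open>V\<close> of a real vector space and a bracket \<open>br\<close>;
  endomorphisms of \<open>V\<close> are functions on the ambient type, constrained on \<open>V\<close> only.
\<close>

definition linear_endo_on :: "'a::real_vector set \<Rightarrow> ('a \<Rightarrow> 'a) \<Rightarrow> bool" where
  "linear_endo_on V f \<longleftrightarrow>
     (\<forall>x\<in>V. f x \<in> V) \<and>
     (\<forall>x\<in>V. \<forall>y\<in>V. f (x + y) = f x + f y) \<and>
     (\<forall>c. \<forall>x\<in>V. f (c *\<^sub>R x) = c *\<^sub>R f x)"

definition nijenhuis :: "('a::real_vector \<Rightarrow> 'a \<Rightarrow> 'a) \<Rightarrow> ('a \<Rightarrow> 'a) \<Rightarrow> 'a \<Rightarrow> 'a \<Rightarrow> 'a" where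
  "nijenhuis br J x y = br x y + J (br (J x) y + br x (J y)) - br (J x) (J y)"

definition complex_structure_on ::
    "'a::real_vector set \<Rightarrow> ('a \<Rightarrow> 'a \<Rightarrow> 'a) \<Rightarrow> ('a \<Rightarrow> 'a) \<Rightarrow> bool" where
  "complex_structure_on V br J \<longleftrightarrow>
     linear_endo_on V J \<and> (\<forall>x\<in>V. J (J x) = - x) \<and>
     (\<forall>x\<in>V. \<forall>y\<in>V. nijenhuis br J x y = 0)"

definition hypercomplex_structure_on ::
    "'a::real_vector set \<Rightarrow> ('a \<Rightarrow> 'a \<Rightarrow> 'a) \<Rightarrow> ('a \<Rightarrow> 'a) \<Rightarrow> ('a \<Rightarrow> 'a) \<Rightarrow> ('a \<Rightarrow> 'a) \<Rightarrow> bool" where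
  "hypercomplex_structure_on V br J1 J2 J3 \<longleftrightarrow>
     complex_structure_on V br J1 \<and> complex_structure_on V br J2 \<and> complex_structure_on V br J3 \<and>
     (\<forall>x\<in>V. J1 (J2 x) = J3 x \<and> - J2 (J1 x) = J3 x)"

section \<open>Complex and hypercomplex structures on embedded submanifolds\<close>

text \<open>
  The definitions below are meant for sets \<open>S\<close> that are smooth embedded submanifolds of a
  Euclidean space; there they agree with the usual intrinsic notions.
\<close>

definition tangent_space :: "'a::euclidean_space set \<Rightarrow> 'a \<Rightarrow> 'a set" where
  "tangent_space S p =
     {v. \<exists>\<gamma>::real \<Rightarrow> 'a. \<gamma> 0 = p \<and> (\<forall>\<^sub>F t in nhds 0. \<gamma> t \<in> S) \<and>
           (\<gamma> has_vector_derivative v) (at 0)}"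

primrec Ck_on_open :: "nat \<Rightarrow> 'a::euclidean_space set \<Rightarrow> ('a \<Rightarrow> 'a) \<Rightarrow> bool" where
  "Ck_on_open 0 U f \<longleftrightarrow> continuous_on U f"
| "Ck_on_open (Suc k) U f \<longleftrightarrow>
     (\<forall>x\<in>U. f differentiable (at x)) \<and>
     (\<forall>v. Ck_on_open k U (\<lambda>x. frechet_derivative f (at x) v))"

definition smooth_map_on :: "'a::euclidean_space set \<Rightarrow> ('a \<Rightarrow> 'a) \<Rightarrow> bool" where
  "smooth_map_on S f \<longleftrightarrow>
     (\<forall>p\<in>S. \<exists>U F. open U \<and> p \<in> U \<and> (\<forall>k. Ck_on_open k U F) \<and> (\<forall>x\<in>S \<inter> U. F x = f x))"

definition smooth_vector_field :: "'a::euclidean_space set \<Rightarrow> ('a \<Rightarrow> 'a) \<Rightarrow> bool" where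
  "smooth_vector_field S X \<longleftrightarrow> smooth_map_on S X \<and> (\<forall>p\<in>S. X p \<in> tangent_space S p)"

text \<open>
  A Frechet derivative within \<open>S\<close> need not be unique, but its values on \<open>tangent_space S p\<close>
  are (chain rule along curves in \<open>S\<close>), and only those are used here.
\<close>

definition vf_bracket :: "'a::euclidean_space set \<Rightarrow> ('a \<Rightarrow> 'a) \<Rightarrow> ('a \<Rightarrow> 'a) \<Rightarrow> 'a \<Rightarrow> 'a" where
  "vf_bracket S X Y p =
     frechet_derivative Y (at p within S) (X p) - frechet_derivative X (at p within S) (Y p)"

text \<open>A \<open>(1,1)\<close>-tensor field is given as \<open>J p v\<close>, for base point \<open>p\<close> and tangent vector \<open>v\<close> at \<open>p\<close>.\<close>

definition vf_nijenhuis ::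
    "'a::euclidean_space set \<Rightarrow> ('a \<Rightarrow> 'a \<Rightarrow> 'a) \<Rightarrow> ('a \<Rightarrow> 'a) \<Rightarrow> ('a \<Rightarrow> 'a) \<Rightarrow> 'a \<Rightarrow> 'a" where
  "vf_nijenhuis S J X Y p =
     (let JX = (\<lambda>q. J q (X q)); JY = (\<lambda>q. J q (Y q)) in
      vf_bracket S X Y p + J p (vf_bracket S JX Y p + vf_bracket S X JY p) - vf_bracket S JX JY p)"

definition manifold_complex_structure ::
    "'a::euclidean_space set \<Rightarrow> ('a \<Rightarrow> 'a \<Rightarrow> 'a) \<Rightarrow> bool" where
  "manifold_complex_structure S J \<longleftrightarrow>
     (\<forall>p\<in>S. linear_endo_on (tangent_space S p) (J p) \<and>
            (\<forall>v\<in>tangent_space S p. J p (J p v) = - v)) \<and>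
     (\<forall>X. smooth_vector_field S X \<longrightarrow> smooth_vector_field S (\<lambda>p. J p (X p))) \<and>
     (\<forall>X Y. smooth_vector_field S X \<longrightarrow> smooth_vector_field S Y \<longrightarrow>
            (\<forall>p\<in>S. vf_nijenhuis S J X Y p = 0))"

definition manifold_hypercomplex_structure ::
    "'a::euclidean_space set \<Rightarrow> ('a \<Rightarrow> 'a \<Rightarrow> 'a) \<Rightarrow> ('a \<Rightarrow> 'a \<Rightarrow> 'a) \<Rightarrow> ('a \<Rightarrow> 'a \<Rightarrow> 'a) \<Rightarrow> bool" where
  "manifold_hypercomplex_structure S J1 J2 J3 \<longleftrightarrow>
     manifold_complex_structure S J1 \<and> manifold_complex_structure S J2 \<and>
     manifold_complex_structure S J3 \<and>
     (\<forall>p\<in>S. \<forall>v\<in>tangent_space S p. J1 p (J2 p v) = J3 p v \<and> - J2 p (J1 p v) = J3 p v)"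

section \<open>The group \<open>SL(3,\<real>)\<close> and its Lie algebra\<close>

definition SL3 :: "(real^3^3) set" where
  "SL3 = {A. det A = 1}"

definition sl3 :: "(real^3^3) set" where
  "sl3 = {x. trace x = 0}"

definition commutator :: "real^'n^'n \<Rightarrow> real^'n^'n \<Rightarrow> real^'n^'n" where
  "commutator x y = x ** y - y ** x"

text \<open>
  Left translation by \<open>g\<close> is the restriction of the linear map \<open>(**) g\<close>, hence its differential
  is again \<open>(**) g\<close>.
\<close>

definition left_invariant ::
    "(real^'n^'n) set \<Rightarrow> (real^'n^'n \<Rightarrow> real^'n^'n \<Rightarrow> real^'n^'n) \<Rightarrow> bool" where
  "left_invariant G J \<longleftrightarrow>
     (\<forall>g\<in>G. \<forall>a\<in>G. \<forall>v\<in>tangent_space G a. J (g ** a) (g ** v) = g ** J a v)"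

end

theory Submission
  imports Defs
begin

text \<open>
  For a complex structure \<open>J\<close> on a unimodular Lie algebra let \<open>\<theta>(x) = Tr (J ad x)\<close> be the Koszul form.
  Taking traces of the vanishing Nijenhuis tensor shows that \<open>\<beta> = \<theta> \<circ> J\<close> satisfies
  \<open>\<beta>[Jx, Jy] = \<beta>[x, y]\<close> and that \<open>\<beta>\<close> is the same functional for the structures of a hypercomplex
  triple.  Writing \<open>\<beta>(x) = tr (b x)\<close>, the kernel of \<open>d\<beta>\<close> is the centralizer of \<open>b\<close>, which is therefore
  a quaternionic subspace.

  If \<open>b \<noteq> 0\<close>, the centralizer is spanned by \<open>b, J\<^sub>1 b, J\<^sub>2 b, J\<^sub>3 b\<close>; integrability and the Jacobi identity
  force it to be abelian or \<open>\<real> \<oplus> so(3)\<close>, so its adjoint operators have imaginary eigenvalues.  A matrix \<open>n\<close>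
  with \<open>n\<^sup>2 = \<tau> n\<close> in the commutant of \<open>b\<close> is therefore central there.  Applied to the product of a
  right and a left eigenvector of \<open>b\<close> this determines the commutant, which turns out to contain
  two rank one matrices, one of square zero, that do not commute.

  If \<open>b = 0\<close>, then the \<open>\<i>\<close>-eigenspace \<open>q\<close> of a single \<open>J\<close> and its conjugate are complementary unimodular
  subalgebras of \<open>sl(3, \<complex>)\<close>.  The determinant of the projection of \<open>Ad(g) q\<close> along the conjugate of \<open>q\<close> is then
  locally constant in \<open>g\<close>, so \<open>Ad(g) q\<close> never meets the conjugate of \<open>q\<close>.  But counting dimensions, \<open>q\<close> contains
  a nonzero matrix with a prescribed kernel vector, and such a matrix is similar to a multiple of
  its conjugate.
\<close>

section \<open>Traces of operators on matrices\<close>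

definition operator_trace :: "('a::euclidean_space \<Rightarrow> 'a) \<Rightarrow> real" where
  "operator_trace f = (\<Sum>b\<in>Basis. f b \<bullet> b)"

lemma operator_trace_add: "operator_trace (\<lambda>x. f x + g x) = operator_trace f + operator_trace g"
  by (simp add: operator_trace_def inner_add_left sum.distrib)

lemma operator_trace_diff: "operator_trace (\<lambda>x. f x - g x) = operator_trace f - operator_trace g"
  by (simp add: operator_trace_def inner_diff_left sum_subtractf)

lemma operator_trace_scaleR: "operator_trace (\<lambda>x. c *\<^sub>R f x) = c * operator_trace f"
  by (simp add: operator_trace_def sum_distrib_left)

lemma operator_trace_minus: "operator_trace (\<lambda>x. - f x) = - operator_trace f"
  by (simp add: operator_trace_def sum_negf)

lemma operator_trace_commute:
  fixes f g :: "'a::euclidean_space \<Rightarrow> 'a"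
  assumes "linear f" "linear g"
  shows "operator_trace (\<lambda>x. f (g x)) = operator_trace (\<lambda>x. g (f x))"
proof -
  have expand: "h (k b) \<bullet> b = (\<Sum>c\<in>Basis. (k b \<bullet> c) * (h c \<bullet> b))" if "linear h" for h k :: "'a \<Rightarrow> 'a" and b
  proof -
    have "h (k b) = h (\<Sum>c\<in>Basis. (k b \<bullet> c) *\<^sub>R c)"
      by (simp add: euclidean_representation)
    also have "\<dots> = (\<Sum>c\<in>Basis. (k b \<bullet> c) *\<^sub>R h c)"
      using that by (simp add: linear_sum linear_scale)
    finally show ?thesis by (simp add: inner_sum_left)
  qed
  have "operator_trace (\<lambda>x. f (g x)) = (\<Sum>b\<in>Basis. \<Sum>c\<in>Basis. (g b \<bullet> c) * (f c \<bullet> b))"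
    by (simp add: operator_trace_def expand[OF assms(1)])
  also have "\<dots> = (\<Sum>c\<in>Basis. \<Sum>b\<in>Basis. (g b \<bullet> c) * (f c \<bullet> b))"
    by (rule sum.swap)
  also have "\<dots> = operator_trace (\<lambda>x. g (f x))"
    by (simp add: operator_trace_def expand[OF assms(2)] mult.commute)
  finally show ?thesis .
qed

section \<open>Bilinearity of matrix products, commutators and the trace\<close>

lemma matrix_diff_ldistrib: "A ** (B - C) = A ** B - A ** (C :: 'a::comm_ring_1^'n^'n)"
  by (simp add: matrix_matrix_mult_def vec_eq_iff algebra_simps sum_subtractf)

lemma matrix_diff_rdistrib: "(B - C) ** A = B ** A - (C :: 'a::comm_ring_1^'n^'n) ** A"
  by (simp add: matrix_matrix_mult_def vec_eq_iff algebra_simps sum_subtractf)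

lemma matrix_minus_left: "(- B) ** A = - ((B :: 'a::comm_ring_1^'n^'n) ** A)"
  by (simp add: matrix_matrix_mult_def vec_eq_iff sum_negf)

lemma matrix_minus_right: "A ** (- B) = - (A ** (B :: 'a::comm_ring_1^'n^'n))"
  by (simp add: matrix_matrix_mult_def vec_eq_iff sum_negf)

lemma matrix_scaleR_left: "(c *\<^sub>R A) ** B = c *\<^sub>R (A ** (B :: 'a::real_algebra_1^'n^'n))"
  by (simp add: matrix_matrix_mult_def vec_eq_iff scaleR_sum_right)

lemma matrix_scaleR_right: "A ** (c *\<^sub>R B) = c *\<^sub>R (A ** (B :: 'a::real_algebra_1^'n^'n))"
  by (simp add: matrix_matrix_mult_def vec_eq_iff scaleR_sum_right)

lemma matrix_add_rdistrib: "(B + C) ** A = B ** A + (C :: 'a::semiring_1^'n^'n) ** A"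
  by (simp add: matrix_matrix_mult_def vec_eq_iff algebra_simps sum.distrib)

lemmas matrix_ring_simps = matrix_add_ldistrib matrix_add_rdistrib matrix_diff_ldistrib
  matrix_diff_rdistrib matrix_minus_left matrix_minus_right matrix_scaleR_left matrix_scaleR_right
  matrix_mul_assoc [symmetric]

lemma linear_matrix_mult_left: "linear (\<lambda>x :: real^'n^'n. (A :: real^'n^'n) ** x)"
  by (rule linearI) (simp_all add: matrix_ring_simps)

lemma linear_matrix_mult_right: "linear (\<lambda>x :: real^'n^'n. x ** (A :: real^'n^'n))"
  by (rule linearI) (simp_all add: matrix_ring_simps)

lemma linear_commutator: "linear (commutator x)"
  by (rule linearI) (simp_all add: commutator_def matrix_ring_simps scaleR_diff_right)

lemma commutator_add_left: "commutator (x + y) z = commutator x z + commutator y z"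
  and commutator_add_right: "commutator z (x + y) = commutator z x + commutator z y"
  and commutator_diff_left: "commutator (x - y) z = commutator x z - commutator y z"
  and commutator_diff_right: "commutator z (x - y) = commutator z x - commutator z y"
  and commutator_minus_left: "commutator (- x) z = - commutator x z"
  and commutator_minus_right: "commutator z (- x) = - commutator z x"
  and commutator_scaleR_left: "commutator (c *\<^sub>R x) z = c *\<^sub>R commutator x z"
  and commutator_scaleR_right: "commutator z (c *\<^sub>R x) = c *\<^sub>R commutator z x"
  by (simp_all add: commutator_def matrix_ring_simps algebra_simps)

lemmas commutator_simps = commutator_add_left commutator_add_right commutator_diff_left
  commutator_diff_right commutator_minus_left commutator_minus_right commutator_scaleR_left
  commutator_scaleR_right

lemma commutator_self [simp]: "commutator x x = 0"
  by (simp add: commutator_def)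

lemma commutator_zero [simp]: "commutator 0 x = 0" "commutator x 0 = 0"
  by (simp_all add: commutator_def)

lemma commutator_mat_1 [simp]: "commutator (mat 1) x = 0" "commutator x (mat 1) = 0"
  by (simp_all add: commutator_def)

lemma commutator_skew: "commutator x y = - commutator y x"
  by (simp add: commutator_def)

lemma commutator_jacobi:
  "commutator (commutator x y) z = commutator x (commutator y z) - commutator y (commutator x z)"
    unfolding commutator_def matrix_diff_ldistrib matrix_diff_rdistrib matrix_mul_assoc
  by (simp only: algebra_simps)

lemma trace_commutator [simp]: "trace (commutator x y) = 0"
  by (simp add: commutator_def trace_sub trace_mul_sym[of x y])

lemma trace_scaleR: "trace (c *\<^sub>R x) = c * trace (x :: real^'n^'n)"
  by (simp add: trace_def sum_distrib_left)

lemma trace_minus: "trace (- x) = - trace (x :: 'a::comm_ring_1^'n^'n)"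
  by (simp add: trace_def sum_negf)

lemma linear_trace: "linear (trace :: real^'n^'n \<Rightarrow> real)"
  by (rule linearI) (simp_all add: trace_add trace_scaleR)

lemma trace_zero [simp]: "trace (0 :: real^'n^'n) = 0"
  by (rule linear_0[OF linear_trace])

text \<open>Both sides equal n tr x. Hence every \<open>commutator x\<close> is traceless on the
  full matrix space, the unimodularity behind the vanishing traces in
  \<open>derivative_of_deformation\<close>.\<close>

lemma operator_trace_mult: "operator_trace (\<lambda>y :: real^'n^'n. x ** y) = operator_trace (\<lambda>y :: real^'n^'n. y ** x)"
proof -
  have axis: "axis i a $ j = (if j = i then a else 0)" for i j :: 'n and a :: real
    by (simp add: axis_def)
  have axis': "axis i a $ j = (if j = i then a else 0)" for i j :: 'n and a :: "real^'n"
    by (simp add: axis_def)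
  have B: "(\<Sum>b\<in>(Basis :: (real^'n^'n) set). F b) = (\<Sum>i\<in>UNIV. \<Sum>j\<in>UNIV. F (axis i (axis j 1)))" for F :: "_ \<Rightarrow> real"
  proof -
    have *: "(Basis :: (real^'n^'n) set) = (\<lambda>(i,j). axis i (axis j 1)) ` UNIV"
      by (auto simp: Basis_vec_def image_iff)
    have **: "inj (\<lambda>(i,j). axis i (axis j 1) :: real^'n^'n)"
      by (auto simp: inj_on_def axis_eq_axis)
    show ?thesis
      unfolding * by (subst sum.reindex[OF **]) (simp add: sum.cartesian_product case_prod_unfold UNIV_Times_UNIV[symmetric] del: UNIV_Times_UNIV)
  qed
  have "operator_trace (\<lambda>y :: real^'n^'n. x ** y) = (\<Sum>i\<in>UNIV. \<Sum>j\<in>(UNIV::'n set). x $ i $ i)"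
    by (simp add: operator_trace_def B inner_axis matrix_matrix_mult_def axis axis' if_distrib[where f="\<lambda>v. v $ _"] if_distrib[where f="\<lambda>v. _ * v"] cong: if_cong)
  moreover have "operator_trace (\<lambda>y :: real^'n^'n. y ** x) = (\<Sum>i\<in>(UNIV::'n set). \<Sum>j\<in>UNIV. x $ j $ j)"
    by (simp add: operator_trace_def B inner_axis matrix_matrix_mult_def axis axis' if_distrib[where f="\<lambda>v. v $ _"] if_distrib[where f="\<lambda>v. v * _"] cong: if_cong)
  ultimately show ?thesis by (simp add: sum_distrib_left)
qed

lemma operator_trace_commutator: "operator_trace (commutator x) = 0"
  using operator_trace_diff[of "\<lambda>y. x ** y" "\<lambda>y. y ** x"]
  by (simp add: commutator_def[abs_def] operator_trace_mult)

section \<open>The Koszul form\<close>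

text \<open>A complex structure on sl(n), extended to all matrices by sending the identity to 0. As
  the image is traceless, the trace of J ad x over all matrices agrees with that over sl(n); as the
  identity is central, integrability extends to all matrices.\<close>

locale complex_structure_matrix =
  fixes J :: "real^'n^'n \<Rightarrow> real^'n^'n"
  assumes linear_J: "linear J"
    and trace_J: "\<And>x. trace (J x) = 0"
    and J_mat_1: "J (mat 1) = 0"
    and J_J: "\<And>x. trace x = 0 \<Longrightarrow> J (J x) = - x"
    and integrable: "\<And>x y. nijenhuis commutator J x y = 0"
begin

lemmas J_add = linear_add [OF linear_J]
  and J_diff = linear_diff [OF linear_J]
  and J_minus = linear_neg [OF linear_J]
  and J_scaleR = linear_scale [OF linear_J]
  and J_zero = linear_0 [OF linear_J]

lemmas J_simps = J_add J_diff J_minus J_scaleR J_zero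

lemma J_J_commutator: "J (J (commutator x y)) = - commutator x y"
  by (rule J_J) simp

definition koszul :: "real^'n^'n \<Rightarrow> real" where
  "koszul x = operator_trace (\<lambda>y. J (commutator x y))"

lemma koszul_add: "koszul (x + y) = koszul x + koszul y"
  by (simp add: koszul_def commutator_simps J_simps operator_trace_add)

lemma koszul_minus: "koszul (- x) = - koszul x"
  by (simp add: koszul_def commutator_simps J_simps operator_trace_minus)

lemma koszul_diff: "koszul (x - y) = koszul x - koszul y"
  by (simp add: koszul_def commutator_simps J_simps operator_trace_diff)

lemma koszul_scaleR: "koszul (c *\<^sub>R x) = c * koszul x"
  by (simp add: koszul_def commutator_simps J_simps operator_trace_scaleR)

lemma linear_comp_J: "linear f \<Longrightarrow> linear (\<lambda>y. f (J y))"
  using linear_compose[OF linear_J, of f] by (simp add: o_def)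

lemma linear_J_comp: "linear f \<Longrightarrow> linear (\<lambda>y. J (f y))"
  using linear_compose[OF _ linear_J, of f] by (simp add: o_def)

lemma linear_comp_commutator: "linear f \<Longrightarrow> linear (\<lambda>y. f (commutator x y))"
  using linear_compose[OF linear_commutator, of f] by (simp add: o_def)

lemmas linear_intros = linear_comp_J linear_J_comp linear_comp_commutator linear_commutator linear_J

lemma integrable_add:
  "commutator x y + J (commutator (J x) y) + J (commutator x (J y)) = commutator (J x) (J y)"
  using integrable[of x y] by (simp add: nijenhuis_def J_add add.assoc)

text \<open>Compose the integrability identity with \<open>commutator w\<close> and take traces. By
  cyclicity the first and third terms are symmetric in x and w, so they cancel against the relation
  with x and w exchanged. By the Jacobi identity the two remaining traces differ by the Koszul form
  of [Jx, w].\<close>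

lemma koszul_skew: "koszul (commutator (J x) w) = koszul (commutator (J w) x)"
proof -
  let ?T = operator_trace
  have E: "?T (\<lambda>y. commutator x (commutator w y)) + ?T (\<lambda>y. J (commutator (J x) (commutator w y)))
      + ?T (\<lambda>y. J (commutator x (J (commutator w y)))) = ?T (\<lambda>y. commutator (J x) (J (commutator w y)))" for x w
    by (simp add: operator_trace_add[symmetric] integrable_add)
  have K: "?T (\<lambda>y. commutator x (commutator w y)) = ?T (\<lambda>y. commutator w (commutator x y))"
    by (rule operator_trace_commute) (rule linear_commutator)+
  have S: "?T (\<lambda>y. J (commutator x (J (commutator w y)))) = ?T (\<lambda>y. J (commutator w (J (commutator x y))))"
    by (rule operator_trace_commute[of "\<lambda>y. J (commutator x y)" "\<lambda>y. J (commutator w y)"]) (intro linear_intros)+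
  have C: "?T (\<lambda>y. commutator (J x) (J (commutator w y))) = ?T (\<lambda>y. J (commutator w (commutator (J x) y)))" for x w
    by (rule operator_trace_commute[of "commutator (J x)" "\<lambda>y. J (commutator w y)"]) (intro linear_intros)+
  have T: "koszul (commutator (J x) w) = ?T (\<lambda>y. J (commutator (J x) (commutator w y)))
      - ?T (\<lambda>y. J (commutator w (commutator (J x) y)))" for x w
    by (simp add: koszul_def commutator_jacobi J_diff operator_trace_diff)
  show ?thesis
    using E[of x w] E[of w x] C[of x w] C[of w x] K S T[of x w] T[of w x] by linarith
qed

lemma J_commutator_diff:
  "J (commutator x y) - J (commutator (J x) (J y)) = commutator (J x) y + commutator x (J y)"
proof -
  let ?s = "commutator (J x) y + commutator x (J y)"
  have "commutator x y - commutator (J x) (J y) = - (J ?s)"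
    using integrable_add[of x y] by (simp add: J_add algebra_simps)
  then have "J (commutator x y - commutator (J x) (J y)) = - J (J ?s)"
    by (metis J_minus)
  then show ?thesis
    by (simp add: J_simps J_J_commutator)
qed

text \<open>By \<open>koszul_skew\<close> the Koszul form vanishes on [Jx, y] + [x, Jy], which
  integrability identifies with J([x, y] - [Jx, Jy]).\<close>

lemma koszul_J_commutator: "koszul (J (commutator (J x) (J y))) = koszul (J (commutator x y))"
proof -
  have "koszul (commutator (J x) y + commutator x (J y)) = 0"
    using koszul_skew[of x y] commutator_skew[of x "J y"] by (simp add: koszul_diff)
  then show ?thesis
    by (simp add: koszul_diff flip: J_commutator_diff)
qed

end

text \<open>Invariance of the trace form turns the hypothesis into tr([b, x] y) = 0 for all y;
  taking y to be the transpose of [b, x] gives a sum of squares.\<close>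

lemma commutator_eq_0_iff:
  fixes b x :: "real^'n^'n"
  assumes "\<And>y. trace (b ** commutator x y) = 0"
  shows "commutator b x = 0"
proof -
  have "trace (commutator b x ** y) = trace (b ** commutator x y)" for y
    by (simp add: commutator_def matrix_ring_simps trace_sub trace_mul_sym[of x])
  then have *: "trace (commutator b x ** y) = 0" for y
    using assms by simp
  have "trace (a ** transpose a) = (\<Sum>i\<in>UNIV. \<Sum>j\<in>UNIV. (a $ i $ j)\<^sup>2)" for a :: "real^'n^'n"
    by (simp add: trace_def matrix_matrix_mult_def transpose_def power2_eq_square)
  then have "(\<Sum>i\<in>UNIV. \<Sum>j\<in>UNIV. (commutator b x $ i $ j)\<^sup>2) = 0"
    using * by metis
  then show ?thesis
    by (simp add: sum_nonneg_eq_0_iff sum_nonneg vec_eq_iff)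
qed

lemma linear_functional_eq_trace:
  fixes f :: "real^'n^'n \<Rightarrow> real"
  assumes "linear f"
  obtains b where "\<And>x. f x = trace (b ** x)"
proof -
  \<comment> \<open>The adjoint of a functional at 1 is its Riesz vector for the entrywise inner
    product; the trace form needs the transpose of it.\<close>
  define c where "c = adjoint f 1"
  have c: "f x = c \<bullet> x" for x
    using adjoint_works[OF assms, of x 1] by (simp add: c_def inner_commute)
  have "f x = trace (transpose c ** x)" for x
  proof -
    have "trace (transpose c ** x) = (\<Sum>i\<in>UNIV. \<Sum>k\<in>UNIV. c $ k $ i * x $ k $ i)"
      by (simp add: trace_def matrix_matrix_mult_def transpose_def)
    also have "\<dots> = (\<Sum>k\<in>UNIV. \<Sum>i\<in>UNIV. c $ k $ i * x $ k $ i)"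
      by (rule sum.swap)
    finally show ?thesis
      by (simp add: c inner_vec_def)
  qed
  then show ?thesis by (rule that)
qed

locale hypercomplex_structure_matrix =
  J1: complex_structure_matrix J1 + J2: complex_structure_matrix J2 + J3: complex_structure_matrix J3
  for J1 J2 J3 :: "real^'n^'n \<Rightarrow> real^'n^'n" +
  assumes J1_J2: "\<And>x. J1 (J2 x) = J3 x" and J2_J1: "\<And>x. J2 (J1 x) = - J3 x"
begin

lemma J1_J3: "J1 (J3 x) = - J2 x"
  using J1.J_J[OF J2.trace_J] by (simp flip: J1_J2)

lemma J3_J1: "J3 (J1 x) = J2 x"
  using J1_J2[of "J1 x"] J1_J3[of x] by (simp add: J2_J1 J1.J_minus)

lemma J2_J3: "J2 (J3 x) = J1 x"
  using J2_J1[of "J2 x"] J1_J2 J2.J_J[OF J1.trace_J, of x] J2_J1[of x] by (metis J2.J_minus neg_equal_iff_equal)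

lemma J3_J2: "J3 (J2 x) = - J1 x"
  using J2_J3[of "J2 x"] J1_J2[of "J2 x"] J3.J_J[OF J1.trace_J] J3_J1[of x] 
  by (metis J3.J_J J1.trace_J)

text \<open>Compose the integrability identity of J1 at z = J2 x with J2 and take traces. Moving J1
  around cyclically makes the terms coincide in pairs, leaving Tr(J2 ad z) = Tr(J3 ad J1 z), where
  J1 z = J3 x.\<close>

lemma koszul_2_eq_3: "J2.koszul (J2 x) = J3.koszul (J3 x)"
proof -
  let ?T = operator_trace
  let ?z = "J2 x"
  have "?T (\<lambda>y. J2 (commutator ?z y)) + ?T (\<lambda>y. J2 (J1 (commutator (J1 ?z) y)))
      + ?T (\<lambda>y. J2 (J1 (commutator ?z (J1 y)))) = ?T (\<lambda>y. J2 (commutator (J1 ?z) (J1 y)))"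
    by (simp add: operator_trace_add[symmetric] J2.J_add[symmetric] J1.integrable_add)
  moreover have "?T (\<lambda>y. J2 (J1 (commutator ?z (J1 y)))) = ?T (\<lambda>y. J1 (J2 (J1 (commutator ?z y))))"
    by (rule operator_trace_commute[of "\<lambda>y. J2 (J1 (commutator ?z y))" J1])
      (intro J2.linear_intros J1.linear_intros)+
  moreover have "?T (\<lambda>y. J2 (commutator (J1 ?z) (J1 y))) = ?T (\<lambda>y. J1 (J2 (commutator (J1 ?z) y)))"
    by (rule operator_trace_commute[of "\<lambda>y. J2 (commutator (J1 ?z) y)" J1])
      (intro J2.linear_intros J1.linear_intros)+
  ultimately have "2 * ?T (\<lambda>y. J2 (commutator ?z y)) = 2 * ?T (\<lambda>y. J3 (commutator (J1 ?z) y))"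
    by (simp add: J2_J1 J1_J2 J1_J3 J1.J_minus operator_trace_minus)
  then show ?thesis
    by (simp add: J2.koszul_def J3.koszul_def J1_J2)
qed

text \<open>The centralizer of b is the radical of the 2-form \<beta>[x, y]. A structure K with
  \<beta>[Kx, Ky] = \<beta>[x, y] preserves it, since \<beta>[Kx, y] = -\<beta>[x, Ky] for traceless
  y. This applies to J2 and J3, and J1 = J2 J3 inherits it.\<close>

lemma koszul_element:
  obtains b where "trace b = 0" "\<And>x. J2.koszul (J2 x) = trace (b ** x)"
    "\<And>x. commutator b x = 0 \<Longrightarrow> trace x = 0 \<Longrightarrow>
       commutator b (J1 x) = 0 \<and> commutator b (J2 x) = 0 \<and> commutator b (J3 x) = 0"
proof -
  let ?\<beta> = "\<lambda>x. J2.koszul (J2 x)"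
  have "linear ?\<beta>"
    by (rule linearI) (simp_all add: J2.J_simps J2.koszul_add J2.koszul_scaleR)
  then obtain b where b: "\<And>x. ?\<beta> x = trace (b ** x)"
    using linear_functional_eq_trace by blast
  have "trace b = ?\<beta> (mat 1)"
    by (simp add: b)
  also have "\<dots> = 0"
    using J2.koszul_scaleR[of 0] by (simp add: J2.J_mat_1)
  finally have tr: "trace b = 0" .
  have kernel: "commutator b x = 0 \<longleftrightarrow> (\<forall>y. ?\<beta> (commutator x y) = 0)" for x
  proof
    assume "commutator b x = 0"
    moreover have "trace (commutator b x ** y) = trace (b ** commutator x y)" for y
      by (simp add: commutator_def matrix_ring_simps trace_sub trace_mul_sym[of x])
    ultimately show "\<forall>y. ?\<beta> (commutator x y) = 0"
      by (simp add: b)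
  qed (auto simp: b intro: commutator_eq_0_iff)
  have inv: "commutator b (K x) = 0"
    if K: "complex_structure_matrix K" "\<And>x y. ?\<beta> (commutator (K x) (K y)) = ?\<beta> (commutator x y)"
      and x: "commutator b x = 0" for K x
  proof -
    interpret K: complex_structure_matrix K by fact
    have "?\<beta> (commutator (K x) y) = 0" for y
    proof -
      \<comment> \<open>K squares to -1 only on traceless matrices; removing the identity component
        does not change commutators.\<close>
      define y0 where "y0 = y - (trace y / real CARD('n)) *\<^sub>R mat 1"
      have "trace y0 = 0"
        by (simp add: y0_def trace_sub trace_scaleR trace_I)
      then have "commutator (K x) y = - commutator (K x) (K (K y0))"
        by (simp add: K.J_J y0_def commutator_simps)
      then show ?thesis
        using K(2)[of x "K y0"] x by (simp add: kernel J2.J_minus J2.koszul_minus)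
    qed
    then show ?thesis by (simp add: kernel)
  qed
  have "commutator b (J2 x) = 0" if "commutator b x = 0" for x
    by (rule inv[OF J2.complex_structure_matrix_axioms J2.koszul_J_commutator that])
  moreover have "commutator b (J3 x) = 0" if "commutator b x = 0" for x
    by (rule inv[OF J3.complex_structure_matrix_axioms _ that])
      (simp add: koszul_2_eq_3 J3.koszul_J_commutator)
  ultimately show ?thesis
    using that[OF tr b] by (metis J2_J3)
qed

end

section \<open>The centralizer of the Koszul element\<close>

context hypercomplex_structure_matrix
begin

lemmas quaternion_simps = J1_J2 J2_J1 J1_J3 J3_J1 J2_J3 J3_J2 J1.J_J J2.J_J J3.J_J
  J1.J_simps J2.J_simps J3.J_simps

text \<open>Applying the conjugate quaternion to the given element produces the squared norm times y
  inside W, so the norm must be 0.\<close>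

lemma quaternion_multiple_in_subspace:
  assumes W: "subspace W" "J1 ` W \<subseteq> W" "J2 ` W \<subseteq> W" "J3 ` W \<subseteq> W"
    and y: "trace y = 0" "y \<notin> W"
    and z: "\<alpha> *\<^sub>R y + \<beta> *\<^sub>R J1 y + \<gamma> *\<^sub>R J2 y + \<delta> *\<^sub>R J3 y \<in> W"
  shows "\<alpha> = 0 \<and> \<beta> = 0 \<and> \<gamma> = 0 \<and> \<delta> = 0"
proof -
  define z where "z = \<alpha> *\<^sub>R y + \<beta> *\<^sub>R J1 y + \<gamma> *\<^sub>R J2 y + \<delta> *\<^sub>R J3 y"
  have "z \<in> W" using z by (simp add: z_def)
  then have "\<alpha> *\<^sub>R z - \<beta> *\<^sub>R J1 z - \<gamma> *\<^sub>R J2 z - \<delta> *\<^sub>R J3 z \<in> W"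
    using W by (intro subspace_diff subspace_scale) auto
  also have "\<alpha> *\<^sub>R z - \<beta> *\<^sub>R J1 z - \<gamma> *\<^sub>R J2 z - \<delta> *\<^sub>R J3 z
      = (\<alpha>\<^sup>2 + \<beta>\<^sup>2 + \<gamma>\<^sup>2 + \<delta>\<^sup>2) *\<^sub>R y"
    using y(1) by (simp add: z_def quaternion_simps algebra_simps power2_eq_square)
  finally have "\<alpha>\<^sup>2 + \<beta>\<^sup>2 + \<gamma>\<^sup>2 + \<delta>\<^sup>2 = 0"
    using W(1) y(2) subspace_scale[of W _ "inverse (\<alpha>\<^sup>2 + \<beta>\<^sup>2 + \<gamma>\<^sup>2 + \<delta>\<^sup>2)"]
    by (metis (no_types, lifting) left_inverse scaleR_one scaleR_scaleR)
  then show ?thesis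
    by (smt (verit) zero_le_power2 power_eq_0_iff)
qed

text \<open>Each inserted vector is independent of the preceding ones, since a relation would put a
  nonzero quaternion multiple of y into W. Quaternionic subspaces thus grow in steps of 4.\<close>

lemma dim_insert_quaternion_line:
  assumes W: "subspace W" "J1 ` W \<subseteq> W" "J2 ` W \<subseteq> W" "J3 ` W \<subseteq> W"
    and y: "trace y = 0" "y \<notin> W"
  shows "dim (insert (J3 y) (insert (J2 y) (insert (J1 y) (insert y W)))) = dim W + 4"
proof -
  note indep = quaternion_multiple_in_subspace[OF W y]
  have "y \<notin> span W"
    using W(1) y by (simp add: span_eq_iff[THEN iffD2])
  moreover have "J1 y \<notin> span (insert y W)"
  proof
    assume "J1 y \<in> span (insert y W)"
    then obtain k where "J1 y - k *\<^sub>R y \<in> W"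
      using W(1) by (auto simp: span_insert span_eq_iff[THEN iffD2])
    then show False
      using indep[of "-k" 1 0 0] by (simp add: algebra_simps)
  qed
  moreover have "J2 y \<notin> span (insert (J1 y) (insert y W))"
  proof
    assume "J2 y \<in> span (insert (J1 y) (insert y W))"
    then obtain k l where "J2 y - k *\<^sub>R J1 y - l *\<^sub>R y \<in> W"
      using W(1) by (auto simp: span_insert span_eq_iff[THEN iffD2])
    then show False
      using indep[of "-l" "-k" 1 0] by (simp add: algebra_simps)
  qed
  moreover have "J3 y \<notin> span (insert (J2 y) (insert (J1 y) (insert y W)))"
  proof
    assume "J3 y \<in> span (insert (J2 y) (insert (J1 y) (insert y W)))"
    then obtain k l m where "J3 y - k *\<^sub>R J2 y - l *\<^sub>R J1 y - m *\<^sub>R y \<in> W"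
      using W(1) by (auto simp: span_insert span_eq_iff[THEN iffD2])
    then show False
      using indep[of "-m" "-l" "-k" 1] by (simp add: algebra_simps)
  qed
  ultimately show ?thesis
    by (simp add: dim_insert)
qed

end

text \<open>Commuting with the matrix units kills the off-diagonal entries and equates the diagonal
  ones, whose common value the trace determines.\<close>

lemma central_matrix:
  fixes b :: "real^'n^'n"
  assumes "\<And>x. commutator b x = 0"
  shows "b = (trace b / real CARD('n)) *\<^sub>R mat 1"
proof -
  define E :: "'n \<Rightarrow> 'n \<Rightarrow> real^'n^'n" where "E = (\<lambda>i j. \<chi> k l. if k = i \<and> l = j then 1 else 0)"
  have eq: "(if l = j then b $ k $ i else 0) = (if k = i then b $ j $ l else 0)" for i j k l
  proof -
    have "(b ** E i j) $ k $ l = (E i j ** b) $ k $ l"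
      using assms[of "E i j"] by (simp add: commutator_def)
    moreover have "(b ** E i j) $ k $ l = (if l = j then b $ k $ i else 0)"
      by (simp add: E_def matrix_matrix_mult_def if_distrib[where f="\<lambda>v. _ * v"] cong: if_cong conj_cong)
    moreover have "(E i j ** b) $ k $ l = (if k = i then b $ j $ l else 0)"
      by (simp add: E_def matrix_matrix_mult_def if_distrib[where f="\<lambda>v. v * _"] cong: if_cong conj_cong)
    ultimately show ?thesis by simp
  qed
  have off: "b $ k $ i = 0" if "k \<noteq> i" for k i
    using eq[of i i k i] that by simp
  have diag: "b $ k $ k = b $ i $ i" for k i
    using eq[of i i k k] by simp
  have "trace b = real CARD('n) * b $ i $ i" for i
    proof -
    have "trace b = (\<Sum>k\<in>(UNIV::'n set). b $ i $ i)"
      unfolding trace_def by (intro sum.cong refl diag)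
    then show ?thesis by simp
  qed
  from this[symmetric] have "trace b / real CARD('n) = b $ i $ i" for i
    by (metis nonzero_mult_div_cancel_left of_nat_0_eq_iff zero_less_card_finite less_irrefl)
  then show ?thesis
    using off by (simp add: vec_eq_iff mat_def)
qed

section \<open>Rank one matrices and real eigenvectors in dimension three\<close>

definition outer :: "real^'n \<Rightarrow> real^'n \<Rightarrow> real^'n^'n" where
  "outer y \<psi> = (\<chi> i j. y $ i * \<psi> $ j)"

lemma outer_mult_outer: "outer y \<psi> ** outer z \<theta> = (\<psi> \<bullet> z) *\<^sub>R outer y \<theta>"
  by (simp add: outer_def vec_eq_iff matrix_matrix_mult_def inner_vec_def sum_distrib_left sum_distrib_right ac_simps)

lemma mult_outer: "x ** outer y \<psi> = outer (x *v y) \<psi>"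
  by (simp add: outer_def vec_eq_iff matrix_matrix_mult_def matrix_vector_mult_def sum_distrib_left sum_distrib_right ac_simps)

lemma outer_mult: "outer y \<psi> ** x = outer y (\<psi> v* x)"
  by (simp add: outer_def vec_eq_iff matrix_matrix_mult_def vector_matrix_mult_def sum_distrib_left ac_simps)

lemma outer_scaleR: "outer (c *\<^sub>R y) \<psi> = c *\<^sub>R outer y \<psi>" "outer y (c *\<^sub>R \<psi>) = c *\<^sub>R outer y \<psi>"
  by (simp_all add: outer_def vec_eq_iff)

lemma outer_add: "outer (y + z) \<psi> = outer y \<psi> + outer z \<psi>" "outer y (\<psi> + \<theta>) = outer y \<psi> + outer y \<theta>"
  by (simp_all add: outer_def vec_eq_iff algebra_simps)

lemma outer_eq_0_iff: "outer y \<psi> = 0 \<longleftrightarrow> y = 0 \<or> \<psi> = 0"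
  by (auto simp: outer_def vec_eq_iff)

lemma depressed_cubic_root: "\<exists>x::real. x ^ 3 + c * x + d = 0"
proof -
  \<comment> \<open>This M satisfies M^3 \<ge> |c| M + |d|, so the cubic changes sign between -M and
    M.\<close>
  define M where "M = 1 + \<bar>c\<bar> + \<bar>d\<bar>"
  have M: "M \<ge> 1" "M \<ge> 1 + \<bar>c\<bar> + \<bar>d\<bar>" by (auto simp: M_def)
  have "M * M \<ge> M" using M by simp
  then have "(M * M) * (1 + \<bar>c\<bar> + \<bar>d\<bar>) \<ge> M * (1 + \<bar>c\<bar> + \<bar>d\<bar>)"
    by (intro mult_right_mono) auto
  moreover have "(M * M) * M \<ge> (M * M) * (1 + \<bar>c\<bar> + \<bar>d\<bar>)"
    using M by (intro mult_left_mono) auto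
  moreover have "M * (1 + \<bar>c\<bar> + \<bar>d\<bar>) \<ge> M * \<bar>c\<bar> + \<bar>d\<bar>"
    using M mult_right_mono[of 1 M "\<bar>d\<bar>"] by (simp add: algebra_simps)
  moreover have "c * M \<le> M * \<bar>c\<bar>" "- (c * M) \<le> M * \<bar>c\<bar>"
    using M mult_left_mono[of c "\<bar>c\<bar>" M] mult_left_mono[of "-c" "\<bar>c\<bar>" M] by (auto simp: mult.commute)
  ultimately have "M ^ 3 + c * M + d \<ge> 0" "(-M) ^ 3 + c * (-M) + d \<le> 0"
    using abs_ge_self[of d] abs_ge_minus_self[of d] by (simp_all add: power3_eq_cube)
  moreover have "continuous_on {-M..M} (\<lambda>x. x ^ 3 + c * x + d)"
    by (intro continuous_intros)
  ultimately show ?thesis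
    using IVT'[of "\<lambda>x. x ^ 3 + c * x + d" "-M" 0 M] M by auto
qed

text \<open>The right and the left eigenvector are taken for the same eigenvalue, so that
  \<open>outer p \<phi>\<close> commutes with b.\<close>

lemma real_eigenvalue_3:
  fixes b :: "real^3^3"
  assumes "trace b = 0"
  obtains \<kappa> p \<phi> where "p \<noteq> 0" "\<phi> \<noteq> 0" "b *v p = \<kappa> *\<^sub>R p" "\<phi> v* b = \<kappa> *\<^sub>R \<phi>"
proof -
  \<comment> \<open>The sum of the principal 2 x 2 minors, which is the linear coefficient of the
    characteristic polynomial; the quadratic one is the trace up to sign.\<close>
  define c where "c = b$1$1 * b$2$2 + b$1$1 * b$3$3 + b$2$2 * b$3$3 - b$1$2 * b$2$1 - b$1$3 * b$3$1 - b$2$3 * b$3$2"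
  obtain \<kappa> where root: "\<kappa> ^ 3 + c * \<kappa> + (- det b) = 0"
    using depressed_cubic_root by blast
  let ?a = "b - \<kappa> *\<^sub>R mat 1"
  have tr: "b$3$3 = - b$1$1 - b$2$2"
    using assms by (simp add: trace_def sum_3)
  have "det ?a = - (\<kappa> ^ 3 + c * \<kappa> + (- det b))"
    by (simp add: det_3 mat_def c_def tr power3_eq_cube algebra_simps)
  then have det: "det ?a = 0" "det (transpose ?a) = 0"
    using root by simp_all
  have "\<not> (\<exists>B. B ** ?a = mat 1)" "\<not> (\<exists>B. B ** transpose ?a = mat 1)"
    using det by (metis det_I det_mul mult_zero_right zero_neq_one)+
  then obtain p \<phi> where p: "p \<noteq> 0" "?a *v p = 0" and \<phi>: "\<phi> \<noteq> 0" "transpose ?a *v \<phi> = 0"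
    unfolding matrix_left_invertible_ker by blast
  have "b *v p = \<kappa> *\<^sub>R p"
    using p(2) by (simp add: matrix_vector_mult_diff_rdistrib scaleR_matrix_vector_assoc[symmetric])
  moreover have "\<phi> v* b = \<kappa> *\<^sub>R \<phi>"
  proof -
    have "transpose ?a = transpose b - \<kappa> *\<^sub>R mat 1"
      by (simp add: transpose_def vec_eq_iff mat_def)
    then show ?thesis
      using \<phi>(2) by (simp add: matrix_vector_mult_diff_rdistrib scaleR_matrix_vector_assoc[symmetric])
  qed
  ultimately show ?thesis using p(1) \<phi>(1) that by blast
qed

lemma independent_pair:
  assumes "independent {u, v}" "u \<noteq> v" "\<alpha> *\<^sub>R u + \<beta> *\<^sub>R v = 0"
  shows "\<alpha> = 0 \<and> \<beta> = 0"
proof -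
  have "(\<Sum>w\<in>{u,v}. (if w = u then \<alpha> else \<beta>) *\<^sub>R w) = 0"
    using assms(2,3) by simp
  note * = independentD[OF assms(1) _ subset_refl this]
  show ?thesis using *[of u] *[of v] assms(2) by simp
qed

lemma orthogonal_complement_pair:
  fixes p :: "real^3"
  assumes "p \<noteq> 0"
  obtains u v where "u \<noteq> v" "independent {u, v}" "u \<bullet> p = 0" "v \<bullet> p = 0" "\<And>w. p \<bullet> w = 0 \<Longrightarrow> \<exists>\<alpha> \<beta>. w = \<alpha> *\<^sub>R u + \<beta> *\<^sub>R v"
proof -
  obtain B where B: "B \<subseteq> {w. p \<bullet> w = 0}" "independent B" "{w. p \<bullet> w = 0} \<subseteq> span B" "card B = dim {w. p \<bullet> w = 0}"
    using basis_exists by blast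
  then have "card B = 2"
    using dim_hyperplane[OF assms] by simp
  then obtain u v where uv: "B = {u, v}" "u \<noteq> v"
    by (auto simp: card_2_iff)
  have "\<exists>\<alpha> \<beta>. w = \<alpha> *\<^sub>R u + \<beta> *\<^sub>R v" if "p \<bullet> w = 0" for w
  proof -
    have "w \<in> span {u, v}" using B(3) that uv by auto
    then obtain \<alpha> \<beta> where "w - \<alpha> *\<^sub>R u - \<beta> *\<^sub>R v = 0"
      by (auto simp: span_insert)
    then show ?thesis
      by (intro exI[of _ \<alpha>] exI[of _ \<beta>]) (simp add: algebra_simps)
  qed
  then show ?thesis
    using that[OF uv(2)] B(1,2) uv(1) by (auto simp: inner_commute)
qed

text \<open>A matrix x commuting with \<open>outer p \<phi>\<close> has p and \<phi> as right and
  left eigenvectors for one common \<mu>. Then x - \<mu> kills p and has image in the kernel of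
  \<phi>, which leaves 4 dimensions; the identity adds one.\<close>

lemma dim_commutant_outer:
  fixes p \<phi> :: "real^3"
  assumes "p \<noteq> 0" "\<phi> \<noteq> 0"
  shows "dim {x. x ** outer p \<phi> = outer p \<phi> ** x} \<le> 5"
proof -
  obtain y1 y2 where y: "\<And>w. \<phi> \<bullet> w = 0 \<Longrightarrow> \<exists>\<alpha> \<beta>. w = \<alpha> *\<^sub>R y1 + \<beta> *\<^sub>R y2"
    using orthogonal_complement_pair[OF assms(2)] by metis
  obtain u v where uv: "u \<noteq> v" "independent {u, v}" "u \<bullet> p = 0" "v \<bullet> p = 0"
      "\<And>w. p \<bullet> w = 0 \<Longrightarrow> \<exists>\<alpha> \<beta>. w = \<alpha> *\<^sub>R u + \<beta> *\<^sub>R v"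
    using orthogonal_complement_pair[OF assms(1)] by metis
  let ?S = "{mat 1, outer y1 u, outer y1 v, outer y2 u, outer y2 v}"
  have "x \<in> span ?S" if x: "x ** outer p \<phi> = outer p \<phi> ** x" for x
  proof -
    obtain j where j: "\<phi> $ j \<noteq> 0" using assms(2) by (auto simp: vec_eq_iff)
    define \<mu> where "\<mu> = (\<phi> v* x) $ j / \<phi> $ j"
    have "(x *v p) $ i * \<phi> $ k = p $ i * (\<phi> v* x) $ k" for i k
      using x by (simp add: mult_outer outer_mult) (simp add: outer_def vec_eq_iff)
    from this[of _ j] have xp: "x *v p = \<mu> *\<^sub>R p"
      using j by (auto simp: \<mu>_def vec_eq_iff field_simps)
    obtain i where i: "p $ i \<noteq> 0" using assms(1) by (auto simp: vec_eq_iff)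
    have \<phi>x: "\<phi> v* x = \<mu> *\<^sub>R \<phi>"
    proof -
      have "outer (\<mu> *\<^sub>R p) \<phi> = outer p (\<phi> v* x)"
        using x xp by (simp add: mult_outer outer_mult)
      then have "outer (\<mu> *\<^sub>R p) \<phi> $ i $ k = outer p (\<phi> v* x) $ i $ k" for k
        by simp
      then have "(\<phi> v* x) $ k = \<mu> * \<phi> $ k" for k
        using i by (simp add: outer_def)
      then show ?thesis by (simp add: vec_eq_iff)
    qed
    define x' where "x' = x - \<mu> *\<^sub>R mat 1"
    have x'p: "x' *v p = 0"
      using xp by (simp add: x'_def matrix_vector_mult_diff_rdistrib scaleR_matrix_vector_assoc[symmetric])
    have \<phi>x': "\<phi> v* x' = 0"
    proof -
      have "transpose x' = transpose x - \<mu> *\<^sub>R mat 1"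
        by (simp add: x'_def transpose_def vec_eq_iff mat_def)
      then have "transpose x' *v \<phi> = 0"
        using \<phi>x by (simp add: matrix_vector_mult_diff_rdistrib scaleR_matrix_vector_assoc[symmetric])
      then show ?thesis by simp
    qed
    \<comment> \<open>The rows of \<open>x'\<close> are orthogonal to p, hence combinations of u and
      v; their coefficients form two columns annihilated by \<phi>.\<close>
    have "\<exists>\<alpha> \<beta>. x' $ i = \<alpha> *\<^sub>R u + \<beta> *\<^sub>R v" for i
    proof (rule uv(5))
      show "p \<bullet> x' $ i = 0"
        using x'p by (simp add: vec_eq_iff matrix_vector_mult_def inner_vec_def mult.commute)
    qed
    then obtain a b where ab: "\<And>i. x' $ i = a i *\<^sub>R u + b i *\<^sub>R v"
      by metis
    have x': "x' = outer (vec_lambda a) u + outer (vec_lambda b) v"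
      by (simp add: vec_eq_iff[of x'] ab) (simp add: outer_def vec_eq_iff)
    have "\<phi> v* x' = (\<phi> \<bullet> vec_lambda a) *\<^sub>R u + (\<phi> \<bullet> vec_lambda b) *\<^sub>R v"
      by (simp add: x' vec_eq_iff vector_matrix_mult_def outer_def inner_vec_def sum.distrib sum_distrib_left sum_distrib_right algebra_simps)
    then have "\<phi> \<bullet> vec_lambda a = 0" "\<phi> \<bullet> vec_lambda b = 0"
      using independent_pair[OF uv(2,1)] \<phi>x' by metis+
    then obtain \<alpha> \<beta> \<gamma> \<delta> where "vec_lambda a = \<alpha> *\<^sub>R y1 + \<beta> *\<^sub>R y2" "vec_lambda b = \<gamma> *\<^sub>R y1 + \<delta> *\<^sub>R y2"
      using y by metis
    then have "x = \<mu> *\<^sub>R mat 1 + (\<alpha> *\<^sub>R outer y1 u + \<beta> *\<^sub>R outer y2 u) + (\<gamma> *\<^sub>R outer y1 v + \<delta> *\<^sub>R outer y2 v)"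
      using x' by (simp add: x'_def outer_add outer_scaleR algebra_simps)
    then show ?thesis
      by (auto intro!: span_add span_scale intro: span_base)
  qed
  then have "dim {x. x ** outer p \<phi> = outer p \<phi> ** x} \<le> card ?S"
    by (intro dim_le_card) auto
  also have "\<dots> \<le> 5"
    by (simp add: card_insert_if)
  finally show ?thesis .
qed


context hypercomplex_structure_matrix
begin

definition centralizer :: "real^'n^'n \<Rightarrow> (real^'n^'n) set" where
  "centralizer b = {x. trace x = 0 \<and> commutator b x = 0}"

lemma subspace_centralizer: "subspace (centralizer b)"
  by (auto simp: subspace_def centralizer_def trace_add trace_scaleR commutator_simps)

lemma span_quaternion_line_invariant:
  assumes "trace b = 0"
  defines "W \<equiv> span {b, J1 b, J2 b, J3 b}"
  shows "J1 ` W \<subseteq> W" "J2 ` W \<subseteq> W" "J3 ` W \<subseteq> W"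
proof -
  have gen: "b \<in> W" "J1 b \<in> W" "J2 b \<in> W" "J3 b \<in> W"
    by (auto simp: W_def span_base)
  have *: "K ` W \<subseteq> W" if K: "linear K" "K ` {b, J1 b, J2 b, J3 b} \<subseteq> W" for K
    using K(2) span_minimal[of "K ` {b, J1 b, J2 b, J3 b}" W] 
    unfolding W_def by (metis linear_span_image K(1) subspace_span)
  have sub: "subspace W" by (simp add: W_def)
  show "J1 ` W \<subseteq> W"
    using gen assms(1) subspace_neg[OF sub]
    by (intro * J1.linear_J) (auto simp: quaternion_simps)
  show "J2 ` W \<subseteq> W"
    using gen assms(1) subspace_neg[OF sub]
    by (intro * J2.linear_J) (auto simp: quaternion_simps)
  show "J3 ` W \<subseteq> W"
    using gen assms(1) subspace_neg[OF sub]
    by (intro * J3.linear_J) (auto simp: quaternion_simps)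
qed

end

section \<open>Dimension three: the centralizer of a nonzero Koszul element\<close>

lemma dim_traceless_3: "dim {x :: real^3^3. trace x = 0} \<le> 8"
proof -
  have sub: "subspace {x :: real^3^3. trace x = 0}"
    by (auto simp: subspace_def trace_add trace_scaleR)
  have "(mat 1 :: real^3^3) \<notin> {x. trace x = 0}"
    by (simp add: trace_I)
  then have "span {x :: real^3^3. trace x = 0} \<subset> span UNIV"
    using sub by (auto simp: span_eq_iff[THEN iffD2])
  from dim_psubset[OF this] show ?thesis
    by simp
qed

locale hypercomplex_structure_matrix_3 = hypercomplex_structure_matrix J1 J2 J3
  for J1 J2 J3 :: "real^3^3 \<Rightarrow> real^3^3" +
  fixes b :: "real^3^3"
  assumes trace_b: "trace b = 0" and b_nonzero: "b \<noteq> 0"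
    and centralizer_invariant: "\<And>x. commutator b x = 0 \<Longrightarrow> trace x = 0 \<Longrightarrow>
      commutator b (J1 x) = 0 \<and> commutator b (J2 x) = 0 \<and> commutator b (J3 x) = 0"
begin

lemma b_in_centralizer: "b \<in> centralizer b"
  by (simp add: centralizer_def trace_b)

lemma J_b_in_centralizer: "J1 b \<in> centralizer b" "J2 b \<in> centralizer b" "J3 b \<in> centralizer b"
  using centralizer_invariant[of b] trace_b
  by (simp_all add: centralizer_def J1.trace_J J2.trace_J J3.trace_J)

lemma dim_quaternion_line: "dim {b, J1 b, J2 b, J3 b} = 4"
proof -
  have "dim (insert (J3 b) (insert (J2 b) (insert (J1 b) (insert b {0})))) = dim {0 :: real^3^3} + 4"
    by (rule dim_insert_quaternion_line)
      (auto simp: subspace_0 J1.J_zero J2.J_zero J3.J_zero trace_b b_nonzero)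
  moreover have "insert (J3 b) (insert (J2 b) (insert (J1 b) (insert b {0}))) = insert 0 {b, J1 b, J2 b, J3 b}"
    by auto
  ultimately show ?thesis
    by (simp add: dim_insert[of 0] span_zero)
qed

text \<open>The centralizer contains the quaternionic line of b. One element outside that line would
  raise its dimension from 4 to 8, all of sl(3); then b would be a traceless central matrix, that
  is, 0.\<close>

lemma centralizer_eq_span: "centralizer b = span {b, J1 b, J2 b, J3 b}"
proof
  let ?W = "span {b, J1 b, J2 b, J3 b}"
  show WC: "?W \<subseteq> centralizer b"
    by (intro span_minimal subspace_centralizer) (simp add: b_in_centralizer J_b_in_centralizer)
  show "centralizer b \<subseteq> ?W"
  proof
    fix y assume y: "y \<in> centralizer b"
    show "y \<in> ?W"
    proof (rule ccontr)
      assume "y \<notin> ?W"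
      let ?V = "insert (J3 y) (insert (J2 y) (insert (J1 y) (insert y ?W)))"
      have tr: "trace y = 0" using y by (simp add: centralizer_def)
      have "dim ?V = dim ?W + 4"
        using span_quaternion_line_invariant[OF trace_b] tr \<open>y \<notin> ?W\<close>
        by (intro dim_insert_quaternion_line) auto
      then have "dim ?V = 8"
        by (simp add: dim_quaternion_line)
      have VC: "?V \<subseteq> centralizer b"
        using WC y centralizer_invariant[of y] tr by (auto simp: centralizer_def J1.trace_J J2.trace_J J3.trace_J)
      have Csl: "centralizer b \<subseteq> {x. trace x = 0}"
        by (auto simp: centralizer_def)
      have "subspace {x :: real^3^3. trace x = 0}"
        by (auto simp: subspace_def trace_add trace_scaleR)
      moreover have "dim {x :: real^3^3. trace x = 0} \<le> dim (centralizer b)"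
        using dim_subset[OF VC] \<open>dim ?V = 8\<close> dim_traceless_3 by linarith
      ultimately have eq: "centralizer b = {x. trace x = 0}"
        using Csl subspace_dim_equal[OF subspace_centralizer] by blast
      have "commutator b x = 0" for x
      proof -
        have "x - (trace x / 3) *\<^sub>R mat 1 \<in> centralizer b"
          by (simp add: eq trace_sub trace_scaleR trace_I)
        then show ?thesis
          by (simp add: centralizer_def commutator_simps)
      qed
      from central_matrix[OF this] show False
        using trace_b b_nonzero by simp
    qed
  qed
qed

text \<open>All brackets are expressed through u = [J1 b, J2 b], which lies in the centralizer. The
  Jacobi identity then says that a quaternion built from the coefficients of u annihilates u, so for
  u \<noteq> 0 only the coefficient of J3 b survives. The algebra is abelian for a = 0 and the sum
  of a line and so(3) otherwise.\<close>

lemma centralizer_relations: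
  obtains a where "commutator (J1 b) (J2 b) = a *\<^sub>R J3 b" "commutator (J1 b) (J3 b) = - a *\<^sub>R J2 b"
    "commutator (J2 b) (J3 b) = a *\<^sub>R J1 b"
proof -
  define u where "u = commutator (J1 b) (J2 b)"
  have comm: "commutator b (J1 b) = 0" "commutator b (J2 b) = 0" "commutator b (J3 b) = 0"
    using J_b_in_centralizer by (auto simp: centralizer_def)
  \<comment> \<open>Integrability of J1 at (b, J2 b), where all brackets with b vanish; the next
    claim uses J2 at (b, J1 b).\<close>
  have u13: "commutator (J1 b) (J3 b) = J1 u"
    using J1.integrable_add[of b "J2 b"] comm by (simp add: J1_J2 u_def J1.J_zero)
  have u23: "commutator (J2 b) (J3 b) = J2 u"
    using J2.integrable_add[of b "J1 b"] comm commutator_skew[of "J2 b" "J1 b"]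
    by (simp add: J2_J1 u_def J2.J_simps commutator_simps)
  have "commutator b u = 0"
  proof -
    have "commutator (commutator (J1 b) (J2 b)) b = 0"
      using comm commutator_skew[of "J1 b" b] commutator_skew[of "J2 b" b] by (simp add: commutator_jacobi)
    then show ?thesis
      using commutator_skew[of b u] by (simp add: u_def)
  qed
  then have "u \<in> centralizer b"
    by (simp add: centralizer_def) (simp add: u_def)
  then obtain a0 a1 a2 a3 where "u - a0 *\<^sub>R b - a1 *\<^sub>R J1 b - a2 *\<^sub>R J2 b - a3 *\<^sub>R J3 b = 0"
    by (auto simp: centralizer_eq_span span_insert)
  then have u: "u = a0 *\<^sub>R b + a1 *\<^sub>R J1 b + a2 *\<^sub>R J2 b + a3 *\<^sub>R J3 b"
    by (simp add: algebra_simps)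
  show ?thesis
  proof (cases "u = 0")
    case True
    then show ?thesis
      using that[of 0] u13 u23 by (simp add: u_def J1.J_zero J2.J_zero)
  next
    case False
    have J1u: "J1 u = a0 *\<^sub>R J1 b - a1 *\<^sub>R b + a2 *\<^sub>R J3 b - a3 *\<^sub>R J2 b"
      using trace_b by (simp add: u quaternion_simps)
    have J2u: "J2 u = a0 *\<^sub>R J2 b - a1 *\<^sub>R J3 b - a2 *\<^sub>R b + a3 *\<^sub>R J1 b"
      using trace_b by (simp add: u quaternion_simps)
    have skew: "commutator (J2 b) (J1 b) = - u" "commutator (J3 b) (J1 b) = - J1 u" "commutator (J3 b) (J2 b) = - J2 u"
      "commutator (J1 b) b = 0" "commutator (J2 b) b = 0" "commutator (J3 b) b = 0"
      using u13 u23 comm commutator_skew[of "J2 b" "J1 b"] commutator_skew[of "J3 b" "J1 b"] commutator_skew[of "J3 b" "J2 b"]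
        commutator_skew[of "J1 b" b] commutator_skew[of "J2 b" b] commutator_skew[of "J3 b" b]
      by (simp_all add: u_def)
    have "commutator u (J3 b) = commutator (J1 b) (J2 u) - commutator (J2 b) (J1 u)"
      using commutator_jacobi[of "J1 b" "J2 b" "J3 b"] by (simp add: u_def[symmetric] u13 u23)
    moreover have "commutator u (J3 b) = a1 *\<^sub>R J1 u + a2 *\<^sub>R J2 u"
      by (subst u) (simp add: commutator_simps comm u13 u23)
    moreover have "commutator (J1 b) (J2 u) = a0 *\<^sub>R u - a1 *\<^sub>R J1 u"
      by (subst J2u) (simp add: commutator_simps skew u13 u_def[symmetric])
    moreover have "commutator (J2 b) (J1 u) = - (a0 *\<^sub>R u) + a2 *\<^sub>R J2 u"
      by (subst J1u) (simp add: commutator_simps skew u23 u_def[symmetric])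
    ultimately have eq: "a1 *\<^sub>R J1 u + a2 *\<^sub>R J2 u = (a0 *\<^sub>R u - a1 *\<^sub>R J1 u) - (- (a0 *\<^sub>R u) + a2 *\<^sub>R J2 u)"
      by simp
    define v where "v = a0 *\<^sub>R u - a1 *\<^sub>R J1 u - a2 *\<^sub>R J2 u"
    have "v + v = (a0 *\<^sub>R u - a1 *\<^sub>R J1 u) - (- (a0 *\<^sub>R u) + a2 *\<^sub>R J2 u) - (a1 *\<^sub>R J1 u + a2 *\<^sub>R J2 u)"
      by (simp add: v_def algebra_simps)
    then have "2 *\<^sub>R v = 0"
      by (simp add: eq scaleR_2)
    \<comment> \<open>The Jacobi identity amounts to 2 v = 0, and v is a quaternion multiple of the
      nonzero u.\<close>
    then have "a0 *\<^sub>R u + (- a1) *\<^sub>R J1 u + (- a2) *\<^sub>R J2 u + 0 *\<^sub>R J3 u \<in> {0}"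
      by (simp add: v_def)
    then have "a0 = 0" "a1 = 0" "a2 = 0"
      using quaternion_multiple_in_subspace[of "{0}" u a0 "-a1" "-a2" 0] False
      by (simp_all add: subspace_0 J1.J_zero J2.J_zero J3.J_zero u_def)
    then show ?thesis
      using that[of a3] u13 u23 J1u J2u u by (simp add: u_def[symmetric])
  qed
qed

text \<open>In the coordinates of J1 b, J2 b, J3 b the operator is a times the cross product with
  (n1, n2, n3), whose cube is minus the squared length times itself. If t = 0, either a or this
  vector vanishes, so the operator is 0 on the centralizer.\<close>

lemma ad_cubed_on_centralizer:
  assumes "n \<in> centralizer b"
  obtains t where "t \<ge> 0"
    "\<And>m. m \<in> centralizer b \<Longrightarrow> commutator n (commutator n (commutator n m)) = - t *\<^sub>R commutator n m"
    "t = 0 \<Longrightarrow> \<forall>m\<in>centralizer b. commutator n m = 0"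
proof -
  obtain a where rel: "commutator (J1 b) (J2 b) = a *\<^sub>R J3 b" "commutator (J1 b) (J3 b) = - a *\<^sub>R J2 b"
    "commutator (J2 b) (J3 b) = a *\<^sub>R J1 b"
    using centralizer_relations by blast
  then have rel': "commutator (J2 b) (J1 b) = - a *\<^sub>R J3 b" "commutator (J3 b) (J1 b) = a *\<^sub>R J2 b"
    "commutator (J3 b) (J2 b) = - a *\<^sub>R J1 b"
    using commutator_skew[of "J2 b" "J1 b"] commutator_skew[of "J3 b" "J1 b"] commutator_skew[of "J3 b" "J2 b"]
    by simp_all
  have comm: "commutator b (J1 b) = 0" "commutator b (J2 b) = 0" "commutator b (J3 b) = 0"
    using J_b_in_centralizer by (auto simp: centralizer_def)
  then have comm': "commutator (J1 b) b = 0" "commutator (J2 b) b = 0" "commutator (J3 b) b = 0"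
    using commutator_skew[of "J1 b" b] commutator_skew[of "J2 b" b] commutator_skew[of "J3 b" b]
    by simp_all
  have expand: "\<exists>m0 m1 m2 m3. m = m0 *\<^sub>R b + m1 *\<^sub>R J1 b + m2 *\<^sub>R J2 b + m3 *\<^sub>R J3 b" if "m \<in> centralizer b" for m
  proof -
    obtain m0 m1 m2 m3 where "m - m0 *\<^sub>R b - m1 *\<^sub>R J1 b - m2 *\<^sub>R J2 b - m3 *\<^sub>R J3 b = 0"
      using \<open>m \<in> centralizer b\<close> by (auto simp: centralizer_eq_span span_insert)
    then show ?thesis
      by (intro exI[of _ m0] exI[of _ m1] exI[of _ m2] exI[of _ m3]) (simp add: algebra_simps)
  qed
  obtain n0 n1 n2 n3 where n: "n = n0 *\<^sub>R b + n1 *\<^sub>R J1 b + n2 *\<^sub>R J2 b + n3 *\<^sub>R J3 b"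
    using expand assms by blast
  define cr where "cr m1 m2 m3 = (a * (n2 * m3 - n3 * m2)) *\<^sub>R J1 b + (a * (n3 * m1 - n1 * m3)) *\<^sub>R J2 b
     + (a * (n1 * m2 - n2 * m1)) *\<^sub>R J3 b" for m1 m2 m3
  have ad: "commutator n (m0 *\<^sub>R b + m1 *\<^sub>R J1 b + m2 *\<^sub>R J2 b + m3 *\<^sub>R J3 b) = cr m1 m2 m3" for m0 m1 m2 m3
    by (simp add: n cr_def commutator_simps rel rel' comm comm' algebra_simps)
  have ad_cr: "commutator n (cr m1 m2 m3) = cr (a * (n2 * m3 - n3 * m2)) (a * (n3 * m1 - n1 * m3)) (a * (n1 * m2 - n2 * m1))" for m1 m2 m3
    using ad[of 0 "a * (n2 * m3 - n3 * m2)" "a * (n3 * m1 - n1 * m3)" "a * (n1 * m2 - n2 * m1)"]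
    by (simp add: cr_def[of m1])
  define t where "t = a\<^sup>2 * (n1\<^sup>2 + n2\<^sup>2 + n3\<^sup>2)"
  show ?thesis
  proof (rule that[of t])
    show "t \<ge> 0" by (simp add: t_def)
    show "commutator n (commutator n (commutator n m)) = - t *\<^sub>R commutator n m" if m: "m \<in> centralizer b" for m
    proof -
      obtain m0 m1 m2 m3 where "m = m0 *\<^sub>R b + m1 *\<^sub>R J1 b + m2 *\<^sub>R J2 b + m3 *\<^sub>R J3 b"
        using expand m by blast
      then show ?thesis
        by (simp add: ad ad_cr) (simp add: cr_def t_def scaleR_add_right[symmetric] algebra_simps power2_eq_square)
    qed
    show "\<forall>m\<in>centralizer b. commutator n m = 0" if "t = 0"
    proof
      fix m assume "m \<in> centralizer b"
      then obtain m0 m1 m2 m3 where m: "m = m0 *\<^sub>R b + m1 *\<^sub>R J1 b + m2 *\<^sub>R J2 b + m3 *\<^sub>R J3 b"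
        using expand by blast
      have "a = 0 \<or> n1 = 0 \<and> n2 = 0 \<and> n3 = 0"
        using \<open>t = 0\<close> unfolding t_def by (smt (verit) mult_eq_0_iff zero_le_power2 power_eq_0_iff)
      then show "commutator n m = 0"
        by (auto simp: m ad cr_def)
    qed
  qed
qed

text \<open>On \<open>centralizer b\<close> the operator \<open>commutator n\<close> is diagonalizable with imaginary eigenvalues, whereas
  \<open>n\<^sup>2 = \<tau> n\<close> makes its cube equal to \<open>\<tau>\<^sup>2 commutator n\<close>.\<close>

lemma quadratic_matrix_central:
  assumes n: "commutator b n = 0" "n ** n = \<tau> *\<^sub>R n" and m: "m \<in> centralizer b"
  shows "commutator n m = 0"
proof -
  \<comment> \<open>The traceless part of n lies in the centralizer of b and has the same
    commutators as n.\<close>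
  define n' where "n' = n - (trace n / 3) *\<^sub>R mat 1"
  have n': "commutator n' x = commutator n x" for x
    by (simp add: n'_def commutator_simps)
  have "n' \<in> centralizer b"
    using n(1) by (simp add: centralizer_def n'_def commutator_simps trace_sub trace_scaleR trace_I)
  from ad_cubed_on_centralizer[OF this] obtain t where t: "t \<ge> 0" "\<And>m. m \<in> centralizer b \<Longrightarrow> commutator n (commutator n (commutator n m)) = - t *\<^sub>R commutator n m"
    "t = 0 \<Longrightarrow> \<forall>m\<in>centralizer b. commutator n m = 0"
    unfolding n' by metis
  have nn: "n ** (n ** x) = \<tau> *\<^sub>R (n ** x)" for x :: "real^3^3"
    by (simp only: matrix_mul_assoc n(2) matrix_scaleR_left)
  note rules = commutator_def matrix_diff_ldistrib matrix_diff_rdistrib matrix_scaleR_left matrix_scaleR_right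
    matrix_add_ldistrib matrix_add_rdistrib matrix_mul_assoc[symmetric] nn n(2)
  have "commutator n (commutator n m) = \<tau> *\<^sub>R (n ** m) + \<tau> *\<^sub>R (m ** n) - 2 *\<^sub>R (n ** (m ** n))"
    unfolding rules by (simp add: scaleR_2)
  then have "commutator n (commutator n (commutator n m)) = \<tau>\<^sup>2 *\<^sub>R commutator n m"
    unfolding power2_eq_square by (simp only: rules) (simp add: scaleR_diff_right)
  then have "(\<tau>\<^sup>2 + t) *\<^sub>R commutator n m = 0"
    using t(2)[OF m] by (simp add: scaleR_add_left neg_eq_iff_add_eq_0 add.commute)
  then consider "commutator n m = 0" | "\<tau>\<^sup>2 + t = 0" by auto
  then show ?thesis
  proof cases
    case 2
    then have "t = 0" using t(1) by (smt (verit) zero_le_power2)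
    then show ?thesis using t(3) m by blast
  qed
qed

lemma koszul_element_contradiction: False
proof -
  obtain \<kappa> p \<phi> where p: "p \<noteq> 0" "\<phi> \<noteq> 0" "b *v p = \<kappa> *\<^sub>R p" "\<phi> v* b = \<kappa> *\<^sub>R \<phi>"
    by (rule real_eigenvalue_3[OF trace_b])
  let ?L = "{x. x ** outer p \<phi> = outer p \<phi> ** x}"
  have L: "?L = span (insert (mat 1) {b, J1 b, J2 b, J3 b})"
  proof -
    have "commutator b (outer p \<phi>) = 0"
      by (simp add: commutator_def mult_outer outer_mult p outer_scaleR)
    \<comment> \<open>Here \<tau> is \<phi> \<bullet> p, since \<open>outer p \<phi>\<close> squares
      to that multiple of itself.\<close>
    from quadratic_matrix_central[OF this outer_mult_outer] have "centralizer b \<subseteq> ?L"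
      by (auto simp: commutator_def)
    then have "insert (mat 1) {b, J1 b, J2 b, J3 b} \<subseteq> ?L"
      using b_in_centralizer J_b_in_centralizer by auto
    moreover have subL: "subspace ?L"
      by (auto simp: subspace_def matrix_ring_simps)
    ultimately have sub: "span (insert (mat 1) {b, J1 b, J2 b, J3 b}) \<subseteq> ?L"
      by (rule span_minimal)
    have "mat 1 \<notin> span {b, J1 b, J2 b, J3 b}"
      by (simp add: centralizer_eq_span[symmetric] centralizer_def trace_I)
    \<comment> \<open>Five dimensions are already the maximum for the commutant of
      \<open>outer p \<phi>\<close>, so the inclusion is an equality.\<close>
    then have "dim (span (insert (mat 1) {b, J1 b, J2 b, J3 b})) = 5"
      by (simp add: dim_insert[of "mat 1"] dim_quaternion_line)
    then show ?thesis
      using subspace_dim_equal[OF subspace_span subL sub] dim_commutant_outer[OF p(1,2)] by simp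
  qed
  have commute_L: "commutator n m = 0" if "n \<in> ?L" "n ** n = 0" "m \<in> ?L" for n m
  proof -
    have traceless: "x - (trace x / 3) *\<^sub>R mat 1 \<in> centralizer b" if "x \<in> ?L" for x
    proof -
      have "x \<in> span (insert (mat 1) {b, J1 b, J2 b, J3 b})"
        using that by (simp only: L)
      then obtain k where k: "x - k *\<^sub>R mat 1 \<in> centralizer b"
        unfolding centralizer_eq_span span_breakdown_eq[of x "mat 1"] by blast
      then have "trace x / 3 = k"
        by (simp add: centralizer_def trace_sub trace_scaleR trace_I)
      then show ?thesis using k by (simp only:)
    qed
    have "commutator b n = 0"
      using traceless[OF that(1)] by (simp add: centralizer_def commutator_simps)
    then have "commutator n (m - (trace m / 3) *\<^sub>R mat 1) = 0"
      using quadratic_matrix_central[of n 0] traceless[OF that(3)] that(2) by simp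
    then show ?thesis by (simp add: commutator_simps)
  qed
  have outer_L: "outer y \<psi> \<in> ?L" if "\<phi> \<bullet> y = 0" "\<psi> \<bullet> p = 0" for y \<psi>
    using that by (simp add: outer_mult_outer)
  \<comment> \<open>If \<phi> is orthogonal to p, then w = \<phi> gives a positive multiple of p.
    Otherwise any w not parallel to p works: crossing a zero result with p would leave a nonzero
    multiple of \<open>cross3 p w\<close>.\<close>
  obtain w where w: "cross3 \<phi> (cross3 p w) \<noteq> 0"
  proof (cases "\<phi> \<bullet> p = 0")
    case True
    have "cross3 \<phi> (cross3 p \<phi>) = (\<phi> \<bullet> \<phi>) *\<^sub>R p - (\<phi> \<bullet> p) *\<^sub>R \<phi>"
      by (rule Lagrange)
    then show ?thesis
      using True p(1,2) by (intro that[of \<phi>]) simp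
  next
    case False
    obtain w where w: "cross3 p w \<noteq> 0"
      using cross_basis_nonzero[OF p(1)] by blast
    have "cross3 \<phi> (cross3 p w) \<noteq> 0"
    proof
      assume *: "cross3 \<phi> (cross3 p w) = 0"
      have "cross3 p (cross3 \<phi> (cross3 p w)) = (p \<bullet> cross3 p w) *\<^sub>R \<phi> - (p \<bullet> \<phi>) *\<^sub>R cross3 p w"
        by (rule Lagrange)
      then show False
        using * False w by (simp add: dot_cross_self inner_commute)
    qed
    then show ?thesis by (rule that)
  qed
  \<comment> \<open>Both \<open>outer y \<psi>\<close> and \<open>outer y' \<psi>\<close> lie in ?L.
    The first squares to zero as \<psi> \<bullet> y = 0, and their commutator is (\<psi> \<bullet>
    y') times the first, with \<psi> \<bullet> y' = -(y \<bullet> y).\<close>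
  define \<psi> where "\<psi> = cross3 p w"
  define y where "y = cross3 \<phi> \<psi>"
  define y' where "y' = cross3 \<phi> y"
  have "y \<noteq> 0" "\<psi> \<noteq> 0" using w by (auto simp: y_def \<psi>_def)
  have orth: "\<psi> \<bullet> p = 0" "\<phi> \<bullet> y = 0" "\<phi> \<bullet> y' = 0" "\<psi> \<bullet> y = 0"
    by (simp_all add: \<psi>_def y_def y'_def dot_cross_self)
  have "\<psi> \<bullet> y' = - (y \<bullet> y)"
    by (simp add: y'_def y_def cross3_simps)
  then have nz: "\<psi> \<bullet> y' \<noteq> 0" using \<open>y \<noteq> 0\<close> by simp
  have "commutator (outer y \<psi>) (outer y' \<psi>) = 0"
    using orth by (intro commute_L outer_L) (auto simp: outer_mult_outer)
  then have "(\<psi> \<bullet> y') *\<^sub>R outer y \<psi> = 0"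
    by (simp add: commutator_def outer_mult_outer orth)
  then show False
    using nz \<open>y \<noteq> 0\<close> \<open>\<psi> \<noteq> 0\<close> by (simp add: outer_eq_0_iff)
qed

end

section \<open>Determinants of operators on matrices\<close>

definition matrix_unit :: "'m \<times> 'n \<Rightarrow> real^'n^'m" where
  "matrix_unit c = (\<chi> i j. if i = fst c \<and> j = snd c then 1 else 0)"

text \<open>Indexing the coordinates of a matrix by pairs makes \<open>det\<close> and
  \<open>trace\<close> available for endomorphisms of a matrix space; \<open>flatten\<close> is the
  coordinate map.\<close>

definition operator_matrix :: "(real^'n^'m \<Rightarrow> real^'n^'m) \<Rightarrow> real^('m \<times> 'n)^('m \<times> 'n)" where
  "operator_matrix f = (\<chi> a c. f (matrix_unit c) $ fst a $ snd a)"

definition flatten :: "real^'n^'m \<Rightarrow> real^('m \<times> 'n)" where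
  "flatten x = (\<chi> a. x $ fst a $ snd a)"

lemma flatten_eq_0_iff: "flatten x = 0 \<longleftrightarrow> x = 0"
  by (auto simp: flatten_def vec_eq_iff)

lemma flatten_surj: "\<exists>x. v = flatten x"
  by (rule exI[of _ "\<chi> i j. v $ (i, j)"]) (simp add: flatten_def vec_eq_iff)

lemma matrix_unit_expansion: "(x :: real^'n^'m) = (\<Sum>c\<in>UNIV. (x $ fst c $ snd c) *\<^sub>R matrix_unit c)"
proof -
  have "(\<Sum>c\<in>UNIV. (x $ fst c $ snd c) *\<^sub>R matrix_unit c) $ i $ j = x $ i $ j" for i :: 'm and j :: 'n
  proof -
    have "(\<Sum>c\<in>UNIV. (x $ fst c $ snd c) *\<^sub>R matrix_unit c) $ i $ j
        = (\<Sum>c\<in>UNIV. if c = (i, j) then x $ fst c $ snd c else 0)"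
      unfolding sum_component by (intro sum.cong refl) (auto simp: matrix_unit_def)
    then show ?thesis by simp
  qed
  then show ?thesis by (simp add: vec_eq_iff)
qed

lemma operator_matrix_mult_flatten:
  assumes "linear f"
  shows "operator_matrix f *v flatten x = flatten (f x)"
proof -
  have "f x = (\<Sum>c\<in>UNIV. (x $ fst c $ snd c) *\<^sub>R f (matrix_unit c))"
    by (subst matrix_unit_expansion[of x]) (simp add: linear_sum[OF assms] linear_scale[OF assms])
  then have "f x $ i $ j = (\<Sum>c\<in>UNIV. (x $ fst c $ snd c) * f (matrix_unit c) $ i $ j)" for i j
    by (simp add: sum_component)
  then show ?thesis
    by (simp add: vec_eq_iff flatten_def operator_matrix_def matrix_vector_mult_def mult.commute)
qed

lemma operator_matrix_compose:
  assumes "linear f"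
  shows "operator_matrix (\<lambda>x. f (g x)) = operator_matrix f ** operator_matrix g"
proof -
  have "operator_matrix (\<lambda>x. f (g x)) $ a $ c = (operator_matrix f *v flatten (g (matrix_unit c))) $ a" for a c
    by (simp add: operator_matrix_mult_flatten[OF assms]) (simp add: operator_matrix_def flatten_def)
  then show ?thesis
    by (simp add: vec_eq_iff) (simp add: matrix_vector_mult_def matrix_matrix_mult_def operator_matrix_def flatten_def)
qed

lemma operator_matrix_add: "operator_matrix (\<lambda>x. f x + g x) = operator_matrix f + operator_matrix g"
  by (simp add: operator_matrix_def vec_eq_iff)

lemma trace_operator_matrix: "trace (operator_matrix f) = operator_trace f"
proof -
  have range: "(Basis :: (real^'n^'m) set) = range matrix_unit"
  proof -
    have "matrix_unit c = axis (fst c) (axis (snd c) 1)" for c :: "'m \<times> 'n"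
      by (auto simp: matrix_unit_def axis_def vec_eq_iff)
    then show ?thesis
      by (auto simp: Basis_vec_def image_iff) metis
  qed
  have inj: "inj (matrix_unit :: 'm \<times> 'n \<Rightarrow> real^'n^'m)"
    by (auto simp: inj_def matrix_unit_def vec_eq_iff split: if_splits)
  have inner: "y \<bullet> matrix_unit c = y $ fst c $ snd c" for y :: "real^'n^'m" and c
  proof -
    have "matrix_unit c = axis (fst c) (axis (snd c) 1 :: real^'n)"
      by (auto simp: matrix_unit_def axis_def vec_eq_iff)
    then show ?thesis by (simp add: inner_axis)
  qed
  show ?thesis
    by (simp add: operator_trace_def range sum.reindex[OF inj] inner)
      (simp add: trace_def operator_matrix_def)
qed

lemma det_operator_matrix_eq_0_iff:
  assumes "linear f"
  shows "det (operator_matrix f) = 0 \<longleftrightarrow> (\<exists>x. x \<noteq> 0 \<and> f x = 0)"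
proof -
  have "det (operator_matrix f) \<noteq> 0 \<longleftrightarrow> (\<forall>v. operator_matrix f *v v = 0 \<longrightarrow> v = 0)"
    by (simp add: invertible_det_nz[symmetric] invertible_left_inverse matrix_left_invertible_ker)
  also have "\<dots> \<longleftrightarrow> (\<forall>x. f x = 0 \<longrightarrow> x = 0)"
    by (metis operator_matrix_mult_flatten[OF assms] flatten_eq_0_iff flatten_surj)
  finally show ?thesis by blast
qed

section \<open>Derivatives of determinants\<close>

lemma det_has_field_derivative:
  fixes A :: "'a::real_normed_field \<Rightarrow> 'a^'n^'n"
  assumes "\<And>i j. ((\<lambda>t. A t $ i $ j) has_field_derivative D $ i $ j) (at s within S)"
  shows "((\<lambda>t. det (A t)) has_field_derivative (\<Sum>i\<in>UNIV. det (\<chi> k. if k = i then D $ k else A s $ k)))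
    (at s within S)"
proof -
  let ?P = "{p. p permutes (UNIV :: 'n set)}"
  have prod: "((\<lambda>t. \<Prod>i\<in>UNIV. A t $ i $ p i) has_field_derivative
      (\<Sum>i\<in>UNIV. D $ i $ p i * (\<Prod>j\<in>UNIV - {i}. A s $ j $ p j))) (at s within S)" for p
  proof -
    have "((\<lambda>t. \<Prod>i\<in>UNIV. A t $ i $ p i) has_derivative
      (\<lambda>y. \<Sum>i\<in>UNIV. (D $ i $ p i * y) * (\<Prod>j\<in>UNIV - {i}. A s $ j $ p j))) (at s within S)"
      by (intro has_derivative_prod) (use assms in \<open>simp add: has_field_derivative_def\<close>)
    moreover have "(\<lambda>y. \<Sum>i\<in>UNIV. (D $ i $ p i * y) * (\<Prod>j\<in>UNIV - {i}. A s $ j $ p j))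
      = (*) (\<Sum>i\<in>UNIV. D $ i $ p i * (\<Prod>j\<in>UNIV - {i}. A s $ j $ p j))"
      by (simp add: fun_eq_iff sum_distrib_left sum_distrib_right ac_simps)
    ultimately show ?thesis
      by (simp only: has_field_derivative_def)
  qed
  have "((\<lambda>t. det (A t)) has_field_derivative
      (\<Sum>p\<in>?P. of_int (sign p) * (\<Sum>i\<in>UNIV. D $ i $ p i * (\<Prod>j\<in>UNIV - {i}. A s $ j $ p j)))) (at s within S)"
    unfolding det_def
    by (intro DERIV_sum DERIV_cmult prod)
  \<comment> \<open>Exchanging the sums collects, for each i, the determinant with row i
    differentiated.\<close>
  moreover have "(\<Sum>p\<in>?P. of_int (sign p) * (\<Sum>i\<in>UNIV. D $ i $ p i * (\<Prod>j\<in>UNIV - {i}. A s $ j $ p j)))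
      = (\<Sum>i\<in>UNIV. det (\<chi> k. if k = i then D $ k else A s $ k))"
  proof -
    have "D $ i $ p i * (\<Prod>j\<in>UNIV - {i}. A s $ j $ p j) = (\<Prod>k\<in>UNIV. (\<chi> k. if k = i then D $ k else A s $ k) $ k $ p k)" for p i
      by (subst prod.remove[of UNIV i]) (auto intro: prod.cong)
    then show ?thesis
      by (simp add: det_def sum_distrib_left) (rule sum.swap)
  qed
  ultimately show ?thesis by simp
qed

text \<open>Row i of BA is a combination of the rows of A, and every row but the i-th produces a
  repeated row. Together with the row-wise derivative this is Jacobi's formula for A' = BA.\<close>

lemma sum_det_row_replaced:
  fixes A B :: "'a::field^'n^'n"
  shows "(\<Sum>i\<in>UNIV. det (\<chi> k. if k = i then (B ** A) $ k else A $ k)) = trace B * det A"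
proof -
  have "det (\<chi> k. if k = i then (B ** A) $ k else A $ k) = B $ i $ i * det A" for i
  proof -
    have "(B ** A) $ k = (\<Sum>j\<in>UNIV. B $ k $ j *s A $ j)" for k
      by (simp add: vec_eq_iff matrix_matrix_mult_def)
    then have "det (\<chi> k. if k = i then (B ** A) $ k else A $ k)
        = det (\<chi> k. if k = i then (\<Sum>j\<in>UNIV. B $ i $ j *s A $ j) else A $ k)"
      by (intro arg_cong[of _ _ det]) (auto simp: vec_eq_iff)
    also have "\<dots> = (\<Sum>j\<in>UNIV. B $ i $ j * det (\<chi> k. if k = i then A $ j else A $ k))"
      by (simp add: det_linear_row_sum det_row_mul)
    also have "\<dots> = (\<Sum>j\<in>UNIV. if j = i then B $ i $ i * det A else 0)"
    proof (rule sum.cong)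
      fix j :: 'n
      show "B $ i $ j * det (\<chi> k. if k = i then A $ j else A $ k) = (if j = i then B $ i $ i * det A else 0)"
      proof (cases "j = i")
        case True
        then have "(\<chi> k. if k = i then A $ j else A $ k) = A"
          by (auto simp: vec_eq_iff)
        then show ?thesis using True by simp
      next
        case False
        then have "det (\<chi> k. if k = i then A $ j else A $ k) = 0"
          by (intro det_identical_rows[of i j]) (auto simp: row_def)
        then show ?thesis using False by simp
      qed
    qed simp
    finally show ?thesis by simp
  qed
  then show ?thesis
    by (simp add: trace_def sum_distrib_right)
qed

text \<open>Writing D = (A N A^-1 + M) A reduces this to Jacobi's formula with a traceless
  coefficient.\<close>

lemma det_has_zero_derivative:
  fixes A :: "real \<Rightarrow> real^'n^'n"
  assumes A: "\<And>i j. ((\<lambda>t. A t $ i $ j) has_field_derivative D $ i $ j) (at s within S)"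
    and D: "D = A s ** N + M ** A s" and tr: "trace N = 0" "trace M = 0"
    and det: "det (A s) \<noteq> 0"
  shows "((\<lambda>t. det (A t)) has_field_derivative 0) (at s within S)"
proof -
  obtain R where R: "A s ** R = mat 1" "R ** A s = mat 1"
    using det by (auto simp: invertible_det_nz[symmetric] invertible_def)
  define B where "B = A s ** N ** R + M"
  have "D = B ** A s"
    unfolding B_def D matrix_add_rdistrib
    by (simp add: R(2) flip: matrix_mul_assoc)
  moreover have "trace B = 0"
    using tr trace_mul_sym[of "A s ** N" R] by (simp add: B_def trace_add R matrix_mul_assoc)
  ultimately show ?thesis
    using det_has_field_derivative[OF A] sum_det_row_replaced[of B "A s"] by (simp only: mult_zero_left)
qed

section \<open>Real and imaginary parts of complex matrices\<close>

definition Re_matrix :: "complex^'n^'m \<Rightarrow> real^'n^'m" where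
  "Re_matrix z = (\<chi> i j. Re (z $ i $ j))"

definition Im_matrix :: "complex^'n^'m \<Rightarrow> real^'n^'m" where
  "Im_matrix z = (\<chi> i j. Im (z $ i $ j))"

definition cscale :: "complex \<Rightarrow> complex^'n^'m \<Rightarrow> complex^'n^'m" where
  "cscale c z = (\<chi> i j. c * z $ i $ j)"

definition cnj_matrix :: "complex^'n^'m \<Rightarrow> complex^'n^'m" where
  "cnj_matrix z = (\<chi> i j. cnj (z $ i $ j))"

definition complex_commutator :: "complex^'n^'n \<Rightarrow> complex^'n^'n \<Rightarrow> complex^'n^'n" where
  "complex_commutator z w = z ** w - w ** z"

lemma Re_matrix_simps:
  "Re_matrix (z + w) = Re_matrix z + Re_matrix w" "Re_matrix (z - w) = Re_matrix z - Re_matrix w"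
  "Re_matrix (c *\<^sub>R z) = c *\<^sub>R Re_matrix z" "Re_matrix (mat 1) = mat 1"
  by (auto simp: Re_matrix_def vec_eq_iff mat_def)

lemma Im_matrix_simps:
  "Im_matrix (z + w) = Im_matrix z + Im_matrix w" "Im_matrix (z - w) = Im_matrix z - Im_matrix w"
  "Im_matrix (c *\<^sub>R z) = c *\<^sub>R Im_matrix z" "Im_matrix (mat 1) = 0"
  by (auto simp: Im_matrix_def vec_eq_iff mat_def)

lemma Re_matrix_commutator:
  "Re_matrix (complex_commutator z w)
    = commutator (Re_matrix z) (Re_matrix w) - commutator (Im_matrix z) (Im_matrix w)"
  by (simp add: complex_commutator_def commutator_def Re_matrix_def Im_matrix_def vec_eq_iff
      matrix_matrix_mult_def sum_subtractf)

lemma Im_matrix_commutator: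
  "Im_matrix (complex_commutator z w)
    = commutator (Re_matrix z) (Im_matrix w) + commutator (Im_matrix z) (Re_matrix w)"
  by (simp add: complex_commutator_def commutator_def Re_matrix_def Im_matrix_def vec_eq_iff
      matrix_matrix_mult_def sum_subtractf sum.distrib)

lemma complex_matrix_eqI: "Re_matrix z = Re_matrix w \<Longrightarrow> Im_matrix z = Im_matrix w \<Longrightarrow> z = w"
  by (simp add: Re_matrix_def Im_matrix_def vec_eq_iff complex_eq_iff)

lemma trace_Re_matrix: "trace (Re_matrix z) = Re (trace z)"
  and trace_Im_matrix: "trace (Im_matrix z) = Im (trace z)"
  by (simp_all add: trace_def Re_matrix_def Im_matrix_def)

lemma complex_commutator_simps:
  "complex_commutator z (w + v) = complex_commutator z w + complex_commutator z v"
  "complex_commutator z (w - v) = complex_commutator z w - complex_commutator z v"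
  "complex_commutator (w + v) z = complex_commutator w z + complex_commutator v z"
  "complex_commutator (w - v) z = complex_commutator w z - complex_commutator v z"
  "complex_commutator z (c *\<^sub>R w) = c *\<^sub>R complex_commutator z w"
  "complex_commutator z (mat 1) = 0" "complex_commutator (mat 1) z = 0"
  by (simp_all add: complex_commutator_def matrix_add_ldistrib matrix_add_rdistrib
      matrix_diff_ldistrib matrix_diff_rdistrib matrix_scaleR_left matrix_scaleR_right scaleR_diff_right)


section \<open>The eigenspaces of J and their deformation under conjugation\<close>

context complex_structure_matrix
begin

text \<open>\<open>holomorphic_part\<close> identifies a real matrix with its component in the \<open>\<i>\<close>-eigenspace of \<open>J\<close>;
  the kernel of \<open>real_projection\<close> is the conjugate eigenspace.\<close>

definition holomorphic_part :: "real^'n^'n \<Rightarrow> complex^'n^'n" where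
  "holomorphic_part x = (\<chi> i j. Complex (x $ i $ j) (- (J x $ i $ j)))"

definition real_projection :: "complex^'n^'n \<Rightarrow> real^'n^'n" where
  "real_projection z = Re_matrix z + J (Im_matrix z)"

lemma Re_holomorphic_part [simp]: "Re_matrix (holomorphic_part x) = x"
  and Im_holomorphic_part [simp]: "Im_matrix (holomorphic_part x) = - J x"
  by (simp_all add: Re_matrix_def Im_matrix_def holomorphic_part_def vec_eq_iff)

lemma linear_real_projection: "linear real_projection"
  by (rule linearI) (simp_all add: real_projection_def Re_matrix_simps Im_matrix_simps J_simps algebra_simps)

lemmas real_projection_simps = linear_add[OF linear_real_projection] linear_diff[OF linear_real_projection]
  linear_scale[OF linear_real_projection] linear_0[OF linear_real_projection]

lemma linear_holomorphic_part: "linear holomorphic_part"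
  by (rule linearI; rule complex_matrix_eqI) (simp_all add: Re_matrix_simps Im_matrix_simps J_simps)

lemma holomorphic_part_mat_1: "holomorphic_part (mat 1) = mat 1"
  by (rule complex_matrix_eqI) (simp_all add: Re_matrix_simps Im_matrix_simps J_mat_1)

lemma real_projection_mat_1: "real_projection (mat 1) = mat 1"
  by (simp add: real_projection_def Re_matrix_simps Im_matrix_simps J_simps)

lemma real_projection_holomorphic_part:
  "trace x = 0 \<Longrightarrow> real_projection (holomorphic_part x) = 2 *\<^sub>R x"
  by (simp add: real_projection_def J_simps J_J scaleR_2)

lemma real_projection_cnj:
  assumes "trace x = 0"
  shows "real_projection (cscale c (cnj_matrix (holomorphic_part x))) = 0"
proof -
  have "Re_matrix (cscale c (cnj_matrix (holomorphic_part x))) = Re c *\<^sub>R x - Im c *\<^sub>R J x"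
    "Im_matrix (cscale c (cnj_matrix (holomorphic_part x))) = Re c *\<^sub>R J x + Im c *\<^sub>R x"
    by (simp_all add: Re_matrix_def Im_matrix_def cscale_def cnj_matrix_def holomorphic_part_def vec_eq_iff)
  then show ?thesis
    using assms by (simp add: real_projection_def J_simps J_J)
qed

lemma trace_real_projection: "trace (real_projection z) = Re (trace z)"
  by (simp add: real_projection_def trace_add trace_J trace_Re_matrix)

lemma trace_holomorphic_part: "trace (holomorphic_part x) = of_real (trace x)"
  by (rule complex_eqI) (simp_all flip: trace_Re_matrix trace_Im_matrix add: trace_minus trace_J)

text \<open>The \<i>-eigenspace is a subalgebra: the imaginary part of the bracket is -([Jx, y] +
  [x, Jy]), which by integrability is -J of the real part.\<close>

lemma complex_commutator_holomorphic_part: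
  "complex_commutator (holomorphic_part x) (holomorphic_part y)
    = holomorphic_part (commutator x y - commutator (J x) (J y))"
  by (rule complex_matrix_eqI)
    (simp_all add: Re_matrix_commutator Im_matrix_commutator J_diff J_commutator_diff commutator_simps)

lemma real_projection_commutator_kernel:
  assumes "real_projection z = 0" "real_projection w = 0"
  shows "real_projection (complex_commutator z w) = 0"
proof -
  have Re: "Re_matrix z = - J (Im_matrix z)" "Re_matrix w = - J (Im_matrix w)"
    using assms by (simp_all add: real_projection_def eq_neg_iff_add_eq_0)
  let ?Y = "Im_matrix z" and ?Z = "Im_matrix w"
  have "real_projection (complex_commutator z w) = commutator (J ?Y) (J ?Z) - commutator ?Y ?Z
      - J (commutator (J ?Y) ?Z) - J (commutator ?Y (J ?Z))"
    by (simp add: real_projection_def Re_matrix_commutator Im_matrix_commutator Re commutator_simps J_simps)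
  then show ?thesis
    by (simp add: algebra_simps flip: integrable_add[of ?Y ?Z])
qed

text \<open>In real coordinates, Ad(g) on the \<i>-eigenspace followed by projection along the
  conjugate one; h stands for the inverse of g. The factor 1/2 makes it the identity on traceless
  matrices for g = h = 1.\<close>

definition deformation :: "complex^'n^'n \<Rightarrow> complex^'n^'n \<Rightarrow> real^'n^'n \<Rightarrow> real^'n^'n" where
  "deformation g h x = (1/2) *\<^sub>R real_projection (g ** holomorphic_part x ** h)"

lemma linear_deformation: "linear (deformation g h)"
  by (rule linearI) (simp_all add: deformation_def linear_add[OF linear_holomorphic_part]
      linear_scale[OF linear_holomorphic_part] matrix_add_ldistrib matrix_add_rdistrib
      matrix_scaleR_left matrix_scaleR_right real_projection_simps scaleR_add_right)

text \<open>If \<open>g\<close> moves along a curve with \<open>g' = k g\<close>, the derivative of \<open>deformation g (inverse g)\<close> is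
  the left hand side below.  As \<open>Ad g\<close> maps the \<open>\<i>\<close>-eigenspace to a complement of the conjugate
  eigenspace, \<open>k\<close> splits into components which normalize either of them.\<close>

lemma derivative_of_deformation:
  assumes koszul: "\<And>x. koszul x = 0"
    and gh: "g ** h = mat 1" "h ** g = mat 1"
    and inj: "\<And>x. deformation g h x = 0 \<Longrightarrow> x = 0"
  obtains N M where "linear N" "linear M" "operator_trace N = 0" "operator_trace M = 0"
    "\<And>x. (1/2) *\<^sub>R real_projection (complex_commutator k (g ** holomorphic_part x ** h))
       = deformation g h (N x) + M (deformation g h x)"
proof -
  let ?T = "deformation g h" and ?p = real_projection and ?i = holomorphic_part
  let ?Ad = "\<lambda>z. g ** z ** h"
  have Ad_mult: "?Ad z ** ?Ad w = ?Ad (z ** w)" for z w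
  proof -
    have "?Ad z ** ?Ad w = g ** z ** (h ** g) ** w ** h"
      by (simp only: matrix_mul_assoc)
    then show ?thesis by (simp add: gh matrix_mul_assoc)
  qed
  then have Ad_comm: "complex_commutator (?Ad z) (?Ad w) = ?Ad (complex_commutator z w)" for z w
    by (simp add: complex_commutator_def matrix_diff_ldistrib matrix_diff_rdistrib)
  have Ad_trace: "trace (?Ad z) = trace z" for z
    by (metis trace_mul_sym matrix_mul_assoc gh(2) matrix_mul_rid matrix_mul_lid)
  have T_trace: "trace (?T x) = trace x / 2" for x
    by (simp add: deformation_def trace_scaleR trace_real_projection Ad_trace trace_holomorphic_part)
  have T_1: "?T (mat 1) = (1/2) *\<^sub>R mat 1"
    by (simp add: deformation_def holomorphic_part_mat_1 gh real_projection_mat_1)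
  define k0 where "k0 = k - cscale (trace k / of_nat CARD('n)) (mat 1)"
  have tr_k0: "trace k0 = 0"
    by (simp add: k0_def trace_sub) (simp add: trace_def cscale_def mat_def)
  have k_k0: "complex_commutator k z = complex_commutator k0 z" for z
  proof -
    have "cscale c (mat 1) ** z = z ** cscale c (mat 1)" for c
      by (simp add: vec_eq_iff cscale_def matrix_matrix_mult_def mat_def if_distrib[where f="\<lambda>v. v * _"] if_distrib[where f="\<lambda>v. _ * v"] mult.commute cong: if_cong)
    then show ?thesis
      by (simp add: k0_def complex_commutator_def matrix_diff_ldistrib matrix_diff_rdistrib)
  qed
  \<comment> \<open>An injective ?T is onto, so k0 splits as ?Ad (?i x1) + k2 with k2 in the kernel
    of the projection.\<close>
  have "surj ?T"
    using inj linear_deformation[of g h]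
    by (intro linear_injective_imp_surjective) (auto simp: linear_injective_0)
  then obtain x1 where x1: "?T x1 = (1/2) *\<^sub>R ?p k0"
    by (metis surjD)
  have tr_x1: "trace x1 = 0"
    using T_trace[of x1] by (simp add: x1 trace_scaleR trace_real_projection tr_k0)
  define k2 where "k2 = k0 - ?Ad (?i x1)"
  have pk2: "?p k2 = 0"
    using x1 by (simp add: k2_def real_projection_simps deformation_def)
  have Rek2: "Re_matrix k2 = - J (Im_matrix k2)"
    using pk2 by (simp add: real_projection_def eq_neg_iff_add_eq_0)
  let ?Y = "Im_matrix k2"
  \<comment> \<open>N is the bracket with the eigenvector ?i x1 in real coordinates. M is the action
    of k2 modulo the kernel of the projection, which is a subalgebra containing k2.\<close>
  define N where "N = (\<lambda>x. commutator x1 x - commutator (J x1) (J x))"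
  define M where "M = (\<lambda>y. (1/2) *\<^sub>R ?p (complex_commutator k2 (?i y)))"
  have M: "M y = (1/2) *\<^sub>R (commutator ?Y (J y) - commutator (J ?Y) y + J (commutator ?Y y)
      + J (commutator (J ?Y) (J y)))" for y
    by (simp add: M_def real_projection_def Re_matrix_commutator Im_matrix_commutator Rek2 commutator_simps J_simps)
  show ?thesis
  proof (rule that[of N M])
    show "linear N"
      unfolding N_def by (intro linear_compose_sub linear_intros)
    show "linear M"
      by (rule linearI) (simp_all add: M commutator_simps J_simps algebra_simps)
    have swap: "operator_trace (\<lambda>y. commutator x (J y)) = koszul x" for x
      unfolding koszul_def by (rule operator_trace_commute) (intro linear_intros)+
    show "operator_trace N = 0"
      by (simp add: N_def operator_trace_diff swap koszul operator_trace_commutator)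
    \<comment> \<open>Cyclicity turns J ad(JY) J into J^2 ad(JY) = -ad(JY), which is traceless. The
      other terms of M give Koszul values or traces of commutator operators.\<close>
    have "operator_trace (\<lambda>y. J (commutator (J ?Y) (J y))) = operator_trace (\<lambda>y. J (J (commutator (J ?Y) y)))"
      by (rule operator_trace_commute[of "\<lambda>y. J (commutator (J ?Y) y)" J]) (intro linear_intros)+
    also have "\<dots> = 0"
      by (simp add: J_J_commutator operator_trace_minus operator_trace_commutator)
    finally have "operator_trace (\<lambda>y. J (commutator (J ?Y) (J y))) = 0" .
    moreover have "operator_trace (\<lambda>y. J (commutator ?Y y)) = 0"
      using koszul by (simp add: koszul_def)
    ultimately show "operator_trace M = 0"
      by (simp add: M[abs_def] operator_trace_scaleR operator_trace_add operator_trace_diff swap koszul operator_trace_commutator)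
    have traceless: "(1/2) *\<^sub>R ?p (complex_commutator k (?Ad (?i x))) = ?T (N x) + M (?T x)"
      if x: "trace x = 0" for x
    proof -
      define z where "z = ?Ad (?i x)"
      have pz: "?p z = 2 *\<^sub>R ?T x" by (simp add: z_def deformation_def)
      \<comment> \<open>z and ?i (?T x) have the same projection, so bracketing their difference
        with k2 stays in the kernel.\<close>
      have "?p (z - ?i (?T x)) = 0"
        using T_trace[of x] x by (simp add: real_projection_simps pz real_projection_holomorphic_part)
      then have "?p (complex_commutator k2 (z - ?i (?T x))) = 0"
        by (rule real_projection_commutator_kernel[OF pk2])
      then have "?p (complex_commutator k2 z) = ?p (complex_commutator k2 (?i (?T x)))"
        by (simp add: complex_commutator_simps real_projection_simps)
      moreover have "complex_commutator k0 z = ?Ad (?i (N x)) + complex_commutator k2 z"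
        by (simp add: k2_def z_def Ad_comm complex_commutator_simps complex_commutator_holomorphic_part N_def)
      ultimately show ?thesis
        by (simp add: k_k0 z_def[symmetric] real_projection_simps M_def scaleR_add_right)
          (simp add: deformation_def)
    qed
    show "(1/2) *\<^sub>R ?p (complex_commutator k (?Ad (?i x))) = ?T (N x) + M (?T x)" for x
    proof -
      define c where "c = trace x / real CARD('n)"
      define x0 where "x0 = x - c *\<^sub>R mat 1"
      have x: "x = x0 + c *\<^sub>R mat 1" by (simp add: x0_def)
      have N1: "N x = N x0"
        by (simp add: N_def x commutator_simps J_simps J_mat_1)
      have "?T x = ?T x0 + (c / 2) *\<^sub>R mat 1"
        by (simp add: x linear_add[OF linear_deformation] linear_scale[OF linear_deformation] T_1)
      then have M1: "M (?T x) = M (?T x0)"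
        by (simp add: M commutator_simps J_simps J_mat_1)
      have "?Ad (?i x) = ?Ad (?i x0) + c *\<^sub>R mat 1"
        by (simp add: x linear_add[OF linear_holomorphic_part] linear_scale[OF linear_holomorphic_part]
            holomorphic_part_mat_1 matrix_add_ldistrib matrix_add_rdistrib matrix_scaleR_left matrix_scaleR_right gh)
      then have "complex_commutator k (?Ad (?i x)) = complex_commutator k (?Ad (?i x0))"
        by (simp add: complex_commutator_simps)
      moreover have "trace x0 = 0"
        by (simp add: x0_def c_def trace_sub trace_scaleR trace_I)
      ultimately show ?thesis
        using traceless[of x0] by (simp add: N1 M1)
    qed
  qed
qed

end

section \<open>Paths of invertible matrices\<close>

lemma has_vector_derivative_vecI:
  fixes f :: "real \<Rightarrow> ('a::euclidean_space)^'n"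
  assumes "\<And>i. ((\<lambda>s. f s $ i) has_vector_derivative f' $ i) (at s within S)"
  shows "(f has_vector_derivative f') (at s within S)"
  unfolding has_vector_derivative_def
proof (subst has_derivative_componentwise_within, rule ballI)
  fix b :: "'a^'n" assume "b \<in> Basis"
  then obtain i u where b: "b = axis i u"
    by (auto simp: Basis_vec_def)
  have "((\<lambda>s. f s $ i \<bullet> u) has_derivative (\<lambda>h. (h *\<^sub>R f' $ i) \<bullet> u)) (at s within S)"
    using assms[of i] by (intro has_derivative_inner_left) (simp add: has_vector_derivative_def)
  then show "((\<lambda>s. f s \<bullet> b) has_derivative (\<lambda>h. (h *\<^sub>R f') \<bullet> b)) (at s within S)"
    by (simp add: b inner_axis)
qed

lemma bounded_bilinear_matrix_mult: "bounded_bilinear ((**) :: complex^'n^'n \<Rightarrow> complex^'n^'n \<Rightarrow> complex^'n^'n)"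
  unfolding bilinear_conv_bounded_bilinear[symmetric] bilinear_def
  by (auto intro!: linearI simp: matrix_add_ldistrib matrix_add_rdistrib matrix_scaleR_left matrix_scaleR_right)

text \<open>Cramer's rule writes the entries of the inverse as quotients of determinants in the
  entries of P, so they are differentiable.\<close>

lemma inverse_path_differentiable:
  fixes P :: "real \<Rightarrow> complex^3^3"
  assumes P: "\<And>s. s \<in> S \<Longrightarrow> (P has_vector_derivative P' s) (at s within S)"
    and det: "\<And>s. s \<in> S \<Longrightarrow> det (P s) \<noteq> 0"
  obtains R R' where "\<And>s. s \<in> S \<Longrightarrow> P s ** R s = mat 1" "\<And>s. s \<in> S \<Longrightarrow> R s ** P s = mat 1"
    "\<And>s. s \<in> S \<Longrightarrow> (R has_vector_derivative R' s) (at s within S)"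
proof -
  define R where "R s = (\<chi> k l. det (\<chi> i j. if j = k then axis l 1 $ i else P s $ i $ j) / det (P s))" for s
  have PR: "P s ** R s = mat 1" if "s \<in> S" for s
  proof -
    have "P s *v (\<chi> k. R s $ k $ l) = axis l 1" for l
      using cramer[OF det[OF that], of "\<chi> k. R s $ k $ l" "axis l 1"] by (simp add: R_def)
    then have "(P s *v (\<chi> k. R s $ k $ l)) $ i = axis l 1 $ i" for i l by simp
    then show ?thesis
      by (simp add: vec_eq_iff matrix_matrix_mult_def matrix_vector_mult_def axis_def mat_def)
  qed
  have entry: "(\<lambda>s. P s $ i $ j) differentiable (at s within S)" if "s \<in> S" for s i j
  proof -
    have "bounded_linear (\<lambda>z :: complex^3^3. z $ i $ j)"
      by (intro bounded_linear_compose[OF bounded_linear_vec_nth] bounded_linear_vec_nth)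
    from bounded_linear.has_vector_derivative[OF this P[OF that]] show ?thesis
      by (auto simp: has_vector_derivative_def differentiable_def)
  qed
  have "(\<lambda>s. R s $ k $ l) differentiable (at s within S)" if "s \<in> S" for s k l
  proof -
    have column: "(\<lambda>s. if j = k then axis l 1 $ i else P s $ i $ j) differentiable (at s within S)" for i j
      using entry[OF that] by (cases "j = k") auto
    show ?thesis
      unfolding R_def det_3 vec_lambda_beta
      by (intro differentiable_divide differentiable_diff differentiable_add differentiable_mult column entry that)
        (use det[OF that] in \<open>simp add: det_3\<close>)
  qed
  then have R: "(R has_vector_derivative (\<chi> k l. vector_derivative (\<lambda>s. R s $ k $ l) (at s within S))) (at s within S)"
    if "s \<in> S" for s
    by (intro has_vector_derivative_vecI) (use that in \<open>simp add: vector_derivative_works[symmetric]\<close>)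
  have RP: "R s ** P s = mat 1" if "s \<in> S" for s
    using PR[OF that] by (simp add: matrix_left_right_inverse)
  show ?thesis
    by (rule that[OF PR RP R])
qed

text \<open>On the complex line through A and Q the determinant is a nonzero polynomial in \<tau>.
  The arcs \<tau> = s + \<i> m s (1 - s) from 0 to 1 meet only at their ends, so all but finitely
  many real m avoid its roots.\<close>

lemma path_of_invertible_matrices:
  fixes A Q :: "complex^3^3"
  assumes "det A \<noteq> 0" "det Q \<noteq> 0"
  obtains P P' where "P 0 = A" "P 1 = Q" "\<And>s. s \<in> {0..1} \<Longrightarrow> det (P s) \<noteq> 0"
    "\<And>s S. (P has_vector_derivative P' s) (at s within S)"
proof -
  define L where "L \<tau> = A + cscale \<tau> (Q - A)" for \<tau>
  have entry: "L \<tau> $ i $ j = poly [:A $ i $ j, Q $ i $ j - A $ i $ j:] \<tau>" for \<tau> i j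
    by (simp add: L_def cscale_def)
  have "\<exists>p. \<forall>\<tau>. det (L \<tau>) = poly p \<tau>"
    unfolding det_3 entry poly_mult[symmetric] poly_add[symmetric] poly_diff[symmetric] by blast
  then obtain p where p: "\<And>\<tau>. det (L \<tau>) = poly p \<tau>"
    by blast
  have L01: "L 0 = A" "L 1 = Q"
    by (simp_all add: L_def cscale_def vec_eq_iff)
  then have "p \<noteq> 0" using p[of 0] assms by auto
  then have fin: "finite {z. poly p z = 0}"
    by (rule poly_roots_finite)
  \<comment> \<open>A root with real part s in (0, 1) lies on one arc only, the one with this m.
    Roots with real part 0 or 1 contribute the value 0 of a division by zero, which merely excludes
    m = 0.\<close>
  define bad where "bad = (\<lambda>z. Im z / (Re z * (1 - Re z))) ` {z. poly p z = 0}"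
  have "finite bad" using fin by (simp add: bad_def)
  then obtain m :: real where m: "m \<notin> bad"
    using ex_new_if_finite infinite_UNIV_char_0 by blast
  define \<tau> where "\<tau> s = complex_of_real s + \<i> * of_real (m * s * (1 - s))" for s
  define \<tau>' where "\<tau>' s = 1 + \<i> * of_real (m * (1 - 2 * s))" for s
  have \<tau>: "(\<tau> has_vector_derivative \<tau>' s) (at s within S)" for s S
  proof -
    have 1: "((\<lambda>s. m * s * (1 - s)) has_real_derivative m * (1 - 2 * s)) (at s within S)"
      by (auto intro!: derivative_eq_intros simp: algebra_simps)
    have 2: "((\<lambda>s. complex_of_real (m * s * (1 - s))) has_vector_derivative of_real (m * (1 - 2 * s))) (at s within S)"
      by (rule has_vector_derivative_of_real[OF 1])
    have 3: "(complex_of_real has_vector_derivative 1) (at s within S)"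
      using has_vector_derivative_of_real[OF DERIV_ident] by simp
    show ?thesis
      unfolding \<tau>_def \<tau>'_def
      by (intro has_vector_derivative_add 3 has_vector_derivative_mult_right 2)
  qed
  show ?thesis
  proof (rule that[of "\<lambda>s. L (\<tau> s)" "\<lambda>s. cscale (\<tau>' s) (Q - A)"])
    show "L (\<tau> 0) = A" "L (\<tau> 1) = Q"
      using L01 by (simp_all add: \<tau>_def)
    show "det (L (\<tau> s)) \<noteq> 0" if s: "s \<in> {0..1}" for s
    proof
      assume "det (L (\<tau> s)) = 0"
      then have root: "poly p (\<tau> s) = 0" by (simp add: p)
      have "s \<noteq> 0" "s \<noteq> 1"
        using root p[of 0] p[of 1] assms L01 by (auto simp: \<tau>_def)
      then have "m = Im (\<tau> s) / (Re (\<tau> s) * (1 - Re (\<tau> s)))"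
        by (simp add: \<tau>_def)
      with root m show False by (auto simp: bad_def)
    qed
    show "((\<lambda>s. L (\<tau> s)) has_vector_derivative cscale (\<tau>' s) (Q - A)) (at s within S)" for s S
    proof (intro has_vector_derivative_vecI)
      fix i j
      have "((\<lambda>s. A $ i $ j + \<tau> s * (Q - A) $ i $ j) has_vector_derivative 0 + \<tau>' s * (Q - A) $ i $ j) (at s within S)"
        by (intro has_vector_derivative_add has_vector_derivative_const has_vector_derivative_mult_left \<tau>)
      then show "((\<lambda>s. L (\<tau> s) $ i $ j) has_vector_derivative cscale (\<tau>' s) (Q - A) $ i $ j) (at s within S)"
        by (simp add: L_def cscale_def)
    qed
  qed
qed

text \<open>A singular traceless matrix satisfies \<open>z\<^sup>3 = \<delta> z\<close>, so up to a scalar its spectrum is real.\<close>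

lemma similar_to_conjugate:
  fixes z :: "complex^3^3"
  assumes z0: "z \<noteq> 0" and tr: "trace z = 0" and ker: "z *v axis 3 1 = 0"
  obtains A Q N c where "det A \<noteq> 0" "det Q \<noteq> 0" "z ** A = A ** N" "cscale c (cnj_matrix z) ** Q = Q ** N"
proof -
  define a b c u v where "a = z$1$1" and "b = z$1$2" and "c = z$2$1" and "u = z$3$1" and "v = z$3$2"
  have zs: "z$1$1 = a" "z$1$2 = b" "z$2$1 = c" "z$3$1 = u" "z$3$2 = v" "z$1$3 = 0" "z$2$3 = 0" "z$3$3 = 0"
    using ker by (simp_all add: a_def b_def c_def u_def v_def vec_eq_iff matrix_vector_mult_def axis_def sum_3
        if_distrib[where f="\<lambda>x. _ * x"] forall_3 cong: if_cong)
  moreover have "z$2$2 = - a"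
    using tr by (simp add: trace_def sum_3 zs eq_neg_iff_add_eq_0 add.commute)
  ultimately have zs: "z$1$1 = a" "z$1$2 = b" "z$2$1 = c" "z$3$1 = u" "z$3$2 = v" "z$1$3 = 0" "z$2$3 = 0" "z$3$3 = 0"
    "z$2$2 = - a" by blast+
  define \<delta> where "\<delta> = a * a + b * c"
  \<comment> \<open>The columns are w, y w, y^2 w. For a cyclic vector w this matrix conjugates y to
    \<open>N\<close>, the companion matrix of X^3 - \<delta> X.\<close>
  define C :: "complex^3^3 \<Rightarrow> complex^3 \<Rightarrow> complex^3^3" where
    "C = (\<lambda>y w. \<chi> i j. if j = 1 then w $ i else if j = 2 then (y *v w) $ i else (y *v (y *v w)) $ i)"
  define N :: "complex^3^3" where
    "N = (\<chi> i j. if i = 2 \<and> j = 1 \<or> i = 3 \<and> j = 2 then 1 else if i = 2 \<and> j = 3 then \<delta> else 0)"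
  show ?thesis
  proof (cases "\<exists>w. det (C z w) \<noteq> 0")
    case True
    then obtain w where w: "det (C z w) \<noteq> 0" by blast
    \<comment> \<open>The scalar e gives the rescaled conjugate matrix the same invariant \<delta>,
      hence the same companion matrix.\<close>
    define e where "e = (if \<delta> = 0 then 1 else csqrt (\<delta> / cnj \<delta>))"
    have e: "e \<noteq> 0" "e * e * cnj \<delta> = \<delta>"
      by (auto simp: e_def simp flip: power2_eq_square)
    let ?y = "cscale e (cnj_matrix z)"
    define w' where "w' = (\<chi> i. cnj (w $ i))"
    have y: "?y $ i $ j = e * cnj (z $ i $ j)" for i j
      by (simp add: cscale_def cnj_matrix_def)
    show ?thesis
    proof (rule that[of "C z w" "C ?y w'" N e])
      show "det (C z w) \<noteq> 0" by fact
      have "det (C ?y w') = e * e * e * cnj (det (C z w))"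
        by (simp add: det_3 C_def w'_def matrix_vector_mult_def sum_3 y) (simp add: algebra_simps)
      then show "det (C ?y w') \<noteq> 0" using w e by simp
      show "z ** C z w = C z w ** N"
        by (simp add: vec_eq_iff forall_3 matrix_matrix_mult_def sum_3 C_def N_def matrix_vector_mult_def zs \<delta>_def)
          (simp add: algebra_simps)
      have \<delta>': "\<delta> = e * e * (cnj a * cnj a + cnj b * cnj c)"
        using e(2) by (simp add: \<delta>_def)
      show "?y ** C ?y w' = C ?y w' ** N"
        by (simp add: vec_eq_iff forall_3 matrix_matrix_mult_def sum_3 C_def N_def matrix_vector_mult_def y zs \<delta>' del: complex_cnj_mult)
          (simp add: algebra_simps)
    qed
  next
    case False
    then have det0: "det (C z (vector [p, q, r])) = 0" for p q r by blast
    \<comment> \<open>Without a cyclic vector the determinant of C vanishes identically in the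
      coordinates of w. This forces \<delta> = 0 and then z to be a nilpotent matrix of rank
      one.\<close>
    have *: "(c * p * p - 2 * a * p * q - b * q * q) * (u * (a * p + b * q) + v * (c * p - a * q) - \<delta> * r) = 0" for p q r
    proof -
      have "det (C z (vector [p, q, r])) = (c * p * p - 2 * a * p * q - b * q * q) * (u * (a * p + b * q) + v * (c * p - a * q) - \<delta> * r)"
        by (simp add: det_3 C_def matrix_vector_mult_def sum_3 zs \<delta>_def algebra_simps)
      then show ?thesis using det0 by simp
    qed
    have rank1: "\<exists>V \<phi>. z = (\<chi> i j. V $ i * \<phi> $ j) \<and> (\<Sum>i\<in>UNIV. V $ i * \<phi> $ i) = 0"
    proof -
      have "\<delta> = 0"
      proof (rule ccontr)
        assume "\<delta> \<noteq> 0"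
        \<comment> \<open>For \<delta> \<noteq> 0 the second factor cannot vanish at both r = 0 and
          r = 1, so the first one does, for all p and q.\<close>
        have "c * p * p - 2 * a * p * q - b * q * q = 0" for p q
        proof -
          have "c * p * p - 2 * a * p * q - b * q * q = 0 \<or> u * (a * p + b * q) + v * (c * p - a * q) - \<delta> * r = 0" for r
            using *[of p q r] by simp
          from this[of 0] this[of 1] show ?thesis using \<open>\<delta> \<noteq> 0\<close> by auto
        qed
        from this[of 1 0] this[of 0 1] this[of 1 1] have "c = 0" "b = 0" "a = 0" by auto
        with \<open>\<delta> \<noteq> 0\<close> show False by (simp add: \<delta>_def)
      qed
      then have aa: "a * a = - b * c" by (simp add: \<delta>_def eq_neg_iff_add_eq_0)
      consider "c \<noteq> 0" | "c = 0" "b \<noteq> 0" | "c = 0" "b = 0" by blast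
      then show ?thesis
      proof cases
        case 1
        then have "u * a + v * c = 0" using *[of 1 0 0] by simp
        then have v: "v = - u * a / c" using 1 by (simp add: field_simps add_eq_0_iff)
        have b: "b = - a * a / c" using 1 aa by (simp add: field_simps)
        show ?thesis
          by (rule exI[of _ "vector [a / c, 1, u / c]"], rule exI[of _ "vector [c, - a, 0]"])
            (simp add: vec_eq_iff forall_3 sum_3 zs v b 1)
      next
        case 2
        then have a: "a = 0" using aa by simp
        have "u * b = 0" using *[of 0 1 0] 2 a by simp
        then have "u = 0" using 2 by simp
        then show ?thesis
          by (intro exI[of _ "vector [1, 0, v / b]"] exI[of _ "vector [0, b, 0]"])
            (simp add: vec_eq_iff forall_3 sum_3 zs a 2)
      next
        case 3
        then have "a = 0" using aa by simp
        then show ?thesis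
          by (intro exI[of _ "vector [0, 0, 1]"] exI[of _ "vector [u, v, 0]"])
            (simp add: vec_eq_iff forall_3 sum_3 zs 3)
      qed
    qed
    then obtain V \<phi> where V: "z = (\<chi> i j. V $ i * \<phi> $ j)" "V$1 * \<phi>$1 + V$2 * \<phi>$2 + V$3 * \<phi>$3 = 0"
      by (auto simp: sum_3)
    \<comment> \<open>The columns are V, the cross product of \<phi> with the conjugate of V, and
      the conjugate of \<phi>. z kills the first two and sends the third to n V. Since E is real,
      conjugating A handles the conjugate of z.\<close>
    define A :: "complex^3^3" where "A = (\<chi> i j. if j = 1 then V $ i else if j = 2
      then (if i = 1 then \<phi>$2 * cnj (V$3) - \<phi>$3 * cnj (V$2) else if i = 2 then \<phi>$3 * cnj (V$1) - \<phi>$1 * cnj (V$3) else \<phi>$1 * cnj (V$2) - \<phi>$2 * cnj (V$1))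
      else cnj (\<phi> $ i))"
    define n where "n = \<phi>$1 * cnj (\<phi>$1) + \<phi>$2 * cnj (\<phi>$2) + \<phi>$3 * cnj (\<phi>$3)"
    define n' where "n' = V$1 * cnj (V$1) + V$2 * cnj (V$2) + V$3 * cnj (V$3)"
    define E :: "complex^3^3" where "E = (\<chi> i j. if i = 1 \<and> j = 3 then n else 0)"
    have nn: "x * cnj x + y * cnj y + w * cnj w = of_real ((cmod x)\<^sup>2 + (cmod y)\<^sup>2 + (cmod w)\<^sup>2)" for x y w
      by (simp flip: complex_norm_square)
    have nz: "x = 0 \<and> y = 0 \<and> w = 0" if "x * cnj x + y * cnj y + w * cnj w = 0" for x y w
      using that unfolding nn of_real_eq_0_iff by (smt (verit) zero_le_power2 power_eq_0_iff norm_eq_zero)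
    have "V \<noteq> 0" "\<phi> \<noteq> 0" using z0 V(1) by (auto simp: vec_eq_iff)
    then have "n \<noteq> 0" "n' \<noteq> 0"
      using nz unfolding n_def n'_def vec_eq_iff forall_3 zero_index by metis+
    have "det A = - (V$1 * \<phi>$1 + V$2 * \<phi>$2 + V$3 * \<phi>$3) * cnj (V$1 * \<phi>$1 + V$2 * \<phi>$2 + V$3 * \<phi>$3) + n * n'"
      by (simp add: det_3 A_def n_def n'_def algebra_simps)
    then have detA: "det A \<noteq> 0"
      using V(2) \<open>n \<noteq> 0\<close> \<open>n' \<noteq> 0\<close> by simp
    have zA: "z ** A = A ** E"
    proof -
      have "V $ k * (V$1 * \<phi>$1 + V$2 * \<phi>$2 + V$3 * \<phi>$3) = 0" for k by (simp add: V(2))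
      note this[of 1] this[of 2] this[of 3]
      then show ?thesis
        by (simp add: vec_eq_iff forall_3 matrix_matrix_mult_def sum_3 V(1) A_def E_def n_def algebra_simps)
    qed
    have cnj_mult: "cnj_matrix (x ** y) = cnj_matrix x ** cnj_matrix y" for x y :: "complex^3^3"
      by (simp add: vec_eq_iff cnj_matrix_def matrix_matrix_mult_def)
    have "cnj_matrix E = E"
      by (simp add: vec_eq_iff cnj_matrix_def E_def n_def mult.commute)
    moreover have "cscale 1 x = x" for x :: "complex^3^3"
      by (simp add: cscale_def vec_eq_iff)
    ultimately have "cscale 1 (cnj_matrix z) ** cnj_matrix A = cnj_matrix A ** E"
      using arg_cong[OF zA, of cnj_matrix] by (simp add: cnj_mult)
    moreover have "det (cnj_matrix A) = cnj (det A)"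
      by (simp add: det_3 cnj_matrix_def)
    ultimately show ?thesis
      by (intro that[of A "cnj_matrix A" E 1] detA zA) (simp_all add: detA)
  qed
qed


section \<open>Constancy of the determinant and nonvanishing of the Koszul form\<close>

context complex_structure_matrix
begin

text \<open>Wherever the determinant is nonzero, \<open>derivative_of_deformation\<close> gives it
  derivative 0. Its square has derivative 2 F F', which also vanishes at the zeros of F, so the
  square is constant on all of S.\<close>

lemma det_deformation_along_path:
  fixes P R :: "real \<Rightarrow> complex^'n^'n" and A B :: "complex^'n^'n"
  assumes koszul: "\<And>x. koszul x = 0"
    and S: "convex S" "\<And>s. s \<in> S \<Longrightarrow> at s within S \<noteq> bot"
    and P: "\<And>s. s \<in> S \<Longrightarrow> (P has_vector_derivative P' s) (at s within S)"
    and R: "\<And>s. s \<in> S \<Longrightarrow> (R has_vector_derivative R' s) (at s within S)"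
    and PR: "\<And>s. s \<in> S \<Longrightarrow> P s ** R s = mat 1" "\<And>s. s \<in> S \<Longrightarrow> R s ** P s = mat 1"
    and AB: "A ** B = mat 1" "B ** A = mat 1"
  shows "\<exists>c. \<forall>s\<in>S. (det (operator_matrix (deformation (P s ** B) (A ** R s))))\<^sup>2 = c"
proof (rule has_field_derivative_zero_constant[OF S(1)])
  fix s assume s: "s \<in> S"
  interpret mult: bounded_bilinear "(**) :: complex^'n^'n \<Rightarrow> complex^'n^'n \<Rightarrow> complex^'n^'n"
    by (rule bounded_bilinear_matrix_mult)
  let ?T = "\<lambda>s. deformation (P s ** B) (A ** R s)" and ?i = holomorphic_part and ?p = real_projection
  have gh: "(P s ** B) ** (A ** R s) = mat 1" "(A ** R s) ** (P s ** B) = mat 1"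
  proof -
    have "(P s ** B) ** (A ** R s) = P s ** (B ** A) ** R s" "(A ** R s) ** (P s ** B) = A ** (R s ** P s) ** B"
      by (simp_all only: matrix_mul_assoc)
    then show "(P s ** B) ** (A ** R s) = mat 1" "(A ** R s) ** (P s ** B) = mat 1"
      using PR s AB by simp_all
  qed
  have R': "R' s = - (R s ** P' s ** R s)"
  proof -
    have "((\<lambda>s. P s ** R s) has_vector_derivative P s ** R' s + P' s ** R s) (at s within S)"
      by (rule mult.has_vector_derivative[OF P[OF s] R[OF s]])
    then have "((\<lambda>s. mat 1) has_vector_derivative P s ** R' s + P' s ** R s) (at s within S)"
      by (rule has_vector_derivative_transform[OF s, rotated]) (simp add: PR)
    then have "P s ** R' s + P' s ** R s = 0"
      using vector_derivative_unique_within[OF S(2)[OF s] _ has_vector_derivative_const] by blast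
    then have "R s ** (P s ** R' s) = - (R s ** (P' s ** R s))"
      by (simp add: eq_neg_iff_add_eq_0 flip: matrix_add_ldistrib)
    then show ?thesis using PR s by (simp add: matrix_mul_assoc)
  qed
  \<comment> \<open>With g = P s ** B this is the logarithmic derivative: g' = k g.\<close>
  define k where "k = P' s ** R s"
  define D where "D x = (1/2) *\<^sub>R ?p (complex_commutator k (P s ** B ** ?i x ** (A ** R s)))" for x
  have entry: "((\<lambda>s. ?T s x $ i $ j) has_field_derivative D x $ i $ j) (at s within S)" for x i j
  proof -
    let ?w = "B ** ?i x ** A"
    have "((\<lambda>s. P s ** ?w ** R s) has_vector_derivative P s ** ?w ** R' s + P' s ** ?w ** R s) (at s within S)"
      by (intro mult.has_vector_derivative R s bounded_linear.has_vector_derivative[OF mult.bounded_linear_left] P)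
    moreover have "P s ** ?w ** R' s + P' s ** ?w ** R s = complex_commutator k (P s ** B ** ?i x ** (A ** R s))"
    proof -
      have "P' s ** ?w ** R s = P' s ** (R s ** P s) ** ?w ** R s"
        using PR s by simp
      then show ?thesis
        by (simp add: R' complex_commutator_def k_def matrix_minus_right matrix_mul_assoc)
    qed
    ultimately have deriv: "((\<lambda>s. P s ** B ** ?i x ** (A ** R s)) has_vector_derivative
        complex_commutator k (P s ** B ** ?i x ** (A ** R s))) (at s within S)"
      by (simp add: matrix_mul_assoc)
    have lin: "bounded_linear (\<lambda>z. ((1/2) *\<^sub>R ?p z) $ i $ j)"
    proof -
      have "linear (\<lambda>z. ((1/2) *\<^sub>R ?p z) $ i $ j)"
        by (rule linearI) (simp_all add: real_projection_simps algebra_simps)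
      then show ?thesis by (simp add: linear_conv_bounded_linear)
    qed
    have "((\<lambda>s. ((1/2) *\<^sub>R ?p (P s ** B ** ?i x ** (A ** R s))) $ i $ j) has_vector_derivative D x $ i $ j) (at s within S)"
      unfolding D_def by (rule bounded_linear.has_vector_derivative[OF lin deriv])
    then show ?thesis
      by (simp only: deformation_def has_real_derivative_iff_has_vector_derivative)
  qed
  let ?F = "\<lambda>s. det (operator_matrix (?T s))"
  have entry': "((\<lambda>s. operator_matrix (?T s) $ a $ c) has_field_derivative operator_matrix D $ a $ c) (at s within S)" for a c
    using entry by (simp add: operator_matrix_def)
  have "\<exists>d. (?F has_field_derivative d) (at s within S) \<and> (?F s \<noteq> 0 \<longrightarrow> d = 0)"
  proof (cases "?F s = 0")
    case True
    then show ?thesis using det_has_field_derivative[OF entry'] by blast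
  next
    case False
    then have inj: "?T s x = 0 \<Longrightarrow> x = 0" for x
      using det_operator_matrix_eq_0_iff[OF linear_deformation] by blast
    obtain N M where NM: "linear N" "linear M" "operator_trace N = 0" "operator_trace M = 0"
      "\<And>x. (1/2) *\<^sub>R ?p (complex_commutator k (P s ** B ** ?i x ** (A ** R s))) = ?T s (N x) + M (?T s x)"
      using derivative_of_deformation[OF koszul gh inj] by metis
    have "D = (\<lambda>x. ?T s (N x) + M (?T s x))"
      by (rule ext) (simp only: D_def NM(5))
    then have "operator_matrix D = operator_matrix (?T s) ** operator_matrix N + operator_matrix M ** operator_matrix (?T s)"
      by (simp only: operator_matrix_add operator_matrix_compose[OF linear_deformation, of _ _ N]
          operator_matrix_compose[OF NM(2), of "?T s"])
    from det_has_zero_derivative[OF entry' this _ _ False] NM(3,4) show ?thesis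
      by (auto simp: trace_operator_matrix)
  qed
  then obtain d where d: "(?F has_field_derivative d) (at s within S)" "?F s \<noteq> 0 \<longrightarrow> d = 0" by blast
  have "((\<lambda>s. (?F s)\<^sup>2) has_field_derivative 2 * ?F s * d) (at s within S)"
    using DERIV_power[OF d(1), of 2] by (simp add: ac_simps)
  then show "((\<lambda>s. (?F s)\<^sup>2) has_field_derivative 0) (at s within S)"
    using d(2) by (cases "?F s = 0") auto
qed

end

text \<open>If the form vanished, the squared determinant F^2 would be constant along a path from A
  to Q. But F 0 \<noteq> 0, because g starts at the identity, while at the end Ad(g) carries the
  eigenvector of x to a multiple of its conjugate, which projects to 0.\<close>

lemma koszul_nonzero:
  fixes J :: "real^3^3 \<Rightarrow> real^3^3"
  assumes "complex_structure_matrix J"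
  shows "\<exists>x. complex_structure_matrix.koszul J x \<noteq> 0"
proof (rule ccontr)
  interpret complex_structure_matrix J by fact
  assume "\<not> ?thesis"
  then have koszul: "\<And>x. koszul x = 0" by blast
  have scaleR: "(r *\<^sub>R z) *v v = r *\<^sub>R (z *v v)" for r and z :: "complex^3^3" and v
    by (simp add: matrix_vector_mult_def vec_eq_iff scaleR_sum_right)
  obtain x where x: "x \<noteq> 0" "trace x = 0" "holomorphic_part x *v axis 3 1 = 0"
  proof -
    let ?f = "\<lambda>x. (holomorphic_part x *v axis 3 1, trace x)"
    have f: "linear ?f"
      by (rule linearI) (simp_all add: linear_add[OF linear_holomorphic_part] linear_scale[OF linear_holomorphic_part]
          matrix_vector_mult_add_rdistrib scaleR trace_add trace_scaleR)
    have "\<not> inj ?f"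
    proof
      \<comment> \<open>The source has real dimension 9, the target 6 + 1.\<close>
      assume "inj ?f"
      then have "dim (range ?f) = dim (UNIV :: (real^3^3) set)"
        by (intro dim_image_eq[OF f]) simp
      moreover have "dim (range ?f) \<le> DIM((complex^3) \<times> real)"
        by (rule dim_subset_UNIV)
      ultimately show False by simp
    qed
    then obtain x where "x \<noteq> 0" "?f x = 0"
      using linear_injective_0[OF f] by blast
    then show ?thesis using that by (simp add: zero_prod_def)
  qed
  let ?z = "holomorphic_part x"
  have z: "?z \<noteq> 0" "trace ?z = 0"
  proof -
    show "?z \<noteq> 0"
      using x(1) Re_holomorphic_part[of x] by (metis Re_matrix_simps(2) diff_self)
    show "trace ?z = 0" by (simp add: trace_holomorphic_part x)
  qed
  obtain A Q N c where AQ: "det A \<noteq> 0" "det Q \<noteq> 0" "?z ** A = A ** N" "cscale c (cnj_matrix ?z) ** Q = Q ** N"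
    using similar_to_conjugate[OF z x(3)] by metis
  obtain P P' where P: "P 0 = A" "P 1 = Q" "\<And>s. s \<in> {0..1} \<Longrightarrow> det (P s) \<noteq> 0"
    "\<And>s S. (P has_vector_derivative P' s) (at s within S)"
    using path_of_invertible_matrices[OF AQ(1,2)] by metis
  obtain R R' where R: "\<And>s. s \<in> {0..1} \<Longrightarrow> P s ** R s = mat 1" "\<And>s. s \<in> {0..1} \<Longrightarrow> R s ** P s = mat 1"
    "\<And>s. s \<in> {0..1} \<Longrightarrow> (R has_vector_derivative R' s) (at s within {0..1})"
    using inverse_path_differentiable[of "{0..1}" P P'] P(3,4) by metis
  have AR: "A ** R 0 = mat 1" "R 0 ** A = mat 1" "Q ** R 1 = mat 1"
    using R(1,2)[of 0] R(1)[of 1] P by simp_all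
  define F where "F s = det (operator_matrix (deformation (P s ** R 0) (A ** R s)))" for s
  have "\<exists>c. \<forall>s\<in>{0..1}. (F s)\<^sup>2 = c"
    unfolding F_def
    by (rule det_deformation_along_path[OF koszul _ _ P(4) R(3,1,2) AR(1,2)])
      (auto simp: at_within_Icc_at trivial_limit_within islimpt_Icc)
  then have "F 0 ^ 2 = F 1 ^ 2"
    by (metis atLeastAtMost_iff le_numeral_extra(3) zero_le_one order_refl)
  moreover have "F 1 = 0"
  proof -
    have "?z = A ** N ** R 0"
      by (metis AQ(3) AR(1) matrix_mul_assoc matrix_mul_rid)
    then have "(Q ** R 0) ** ?z ** (A ** R 1) = Q ** (R 0 ** A) ** N ** (R 0 ** A) ** R 1"
      by (simp add: matrix_mul_assoc)
    also have "\<dots> = cscale c (cnj_matrix ?z) ** Q ** R 1"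
      by (simp add: AR AQ(4))
    also have "\<dots> = cscale c (cnj_matrix ?z)"
      by (simp add: AR flip: matrix_mul_assoc)
    finally have "deformation (P 1 ** R 0) (A ** R 1) x = 0"
      by (simp add: deformation_def P real_projection_cnj[OF x(2)])
    then show ?thesis
      unfolding F_def using det_operator_matrix_eq_0_iff[OF linear_deformation] x(1) by blast
  qed
  moreover have "F 0 \<noteq> 0"
  proof -
    have "y = 0" if "deformation (mat 1) (mat 1) y = 0" for y
    proof -
      \<comment> \<open>The hypothesis reads y = J (J y), and images of J are traceless.\<close>
      have "trace y - trace (J (J y)) = 0"
        using that by (simp add: deformation_def real_projection_def J_minus flip: trace_sub)
      then have "trace y = 0" by (simp add: trace_J)
      then show ?thesis
        using that by (simp add: deformation_def real_projection_holomorphic_part)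
    qed
    then show ?thesis
      unfolding F_def using det_operator_matrix_eq_0_iff[OF linear_deformation] by (simp add: P AR) blast
  qed
  ultimately show False by simp
qed

section \<open>Left-invariant structures on the group\<close>

lemma traceless_part:
  fixes x :: "real^'n^'n"
  shows "trace (x - (trace x / real CARD('n)) *\<^sub>R mat 1) = 0"
  by (simp add: trace_sub trace_scaleR trace_I)

lemma complex_structure_matrix_extension:
  fixes J :: "real^'n^'n \<Rightarrow> real^'n^'n"
  assumes J: "complex_structure_on {x. trace x = 0} commutator J"
  shows "complex_structure_matrix (\<lambda>x. J (x - (trace x / real CARD('n)) *\<^sub>R mat 1))"
proof (rule complex_structure_matrix.intro)
  let ?\<pi> = "\<lambda>x :: real^'n^'n. x - (trace x / real CARD('n)) *\<^sub>R mat 1"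
  let ?K = "\<lambda>x. J (?\<pi> x)"
  have J_V: "trace (J x) = 0" and J_add: "J (x + y) = J x + J y" and J_scale: "J (c *\<^sub>R x) = c *\<^sub>R J x"
    and J_J: "J (J x) = - x" and N: "nijenhuis commutator J x y = 0" if "trace x = 0" "trace y = 0" for x y c
    using J that by (auto simp: complex_structure_on_def linear_endo_on_def)
  have \<pi>_V: "trace (?\<pi> x) = 0" for x by (rule traceless_part)
  have \<pi>_id: "?\<pi> x = x" if "trace x = 0" for x using that by simp
  have K_eq: "?K x = J x" if "trace x = 0" for x using that by simp
  show "linear ?K"
  proof (rule linearI)
    fix x y and c :: real
    have "?\<pi> (x + y) = ?\<pi> x + ?\<pi> y"
      by (simp add: trace_add add_divide_distrib scaleR_add_left)
    then show "?K (x + y) = ?K x + ?K y"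
      by (simp only: J_add \<pi>_V)
    have "?\<pi> (c *\<^sub>R x) = c *\<^sub>R ?\<pi> x"
      by (simp add: trace_scaleR scaleR_diff_right)
    then show "?K (c *\<^sub>R x) = c *\<^sub>R ?K x"
      by (simp only: J_scale[OF \<pi>_V \<pi>_V])
  qed
  show "trace (?K x) = 0" for x by (rule J_V[OF \<pi>_V \<pi>_V])
  show "?K (mat 1) = 0"
    using J_scale[of 0 0 0] by (simp add: trace_I)
  show "?K (?K x) = - x" if "trace x = 0" for x
    using that J_V[of x x] J_J[of x x] by simp
  show "nijenhuis commutator ?K x y = 0" for x y
  proof -
    have comm: "commutator (?\<pi> x) z = commutator x z" "commutator z (?\<pi> x) = commutator z x" for x z
      by (simp_all add: commutator_simps)
    have "?K (commutator (?K x) y + commutator x (?K y)) = J (commutator (?K x) y + commutator x (?K y))"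
      by (rule K_eq) (simp add: trace_add)
    then have "nijenhuis commutator ?K x y = nijenhuis commutator J (?\<pi> x) (?\<pi> y)"
      by (simp only: nijenhuis_def comm)
    also have "\<dots> = 0" by (rule N[OF \<pi>_V \<pi>_V])
    finally show ?thesis .
  qed
qed

text \<open>A zero b would make the Koszul form of the second structure vanish, against
  \<open>koszul_nonzero\<close>; a nonzero b is refuted through its centralizer.\<close>

lemma no_hypercomplex_structure_sl3: "\<not> hypercomplex_structure_on sl3 commutator J1 J2 J3"
proof
  assume H: "hypercomplex_structure_on sl3 commutator J1 J2 J3"
  define K where "K J x = J (x - (trace x / 3) *\<^sub>R mat 1)" for J :: "real^3^3 \<Rightarrow> real^3^3" and x
  have H': "complex_structure_on {x. trace x = 0} commutator J1" "complex_structure_on {x. trace x = 0} commutator J2"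
     "complex_structure_on {x. trace x = 0} commutator J3"
     "\<And>x. trace x = 0 \<Longrightarrow> J1 (J2 x) = J3 x" "\<And>x. trace x = 0 \<Longrightarrow> - J2 (J1 x) = J3 x"
    using H by (auto simp: hypercomplex_structure_on_def sl3_def)
  have K: "complex_structure_matrix (K J)" if "complex_structure_on {x. trace x = 0} commutator J" for J
    using complex_structure_matrix_extension[OF that] by (simp add: K_def[abs_def])
  interpret K1: complex_structure_matrix "K J1" by (rule K) fact
  interpret K2: complex_structure_matrix "K J2" by (rule K) fact
  interpret K3: complex_structure_matrix "K J3" by (rule K) fact
  have K_V: "trace (J x) = 0" if "complex_structure_on {x. trace x = 0} commutator J" "trace x = 0" for J :: "real^3^3 \<Rightarrow> real^3^3" and x
    using that by (auto simp: complex_structure_on_def linear_endo_on_def)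
  have tr: "trace (x - (trace x / 3) *\<^sub>R mat 1 :: real^3^3) = 0" for x
    using traceless_part[of x] by simp
  interpret hypercomplex_structure_matrix "K J1" "K J2" "K J3"
  proof
    show "K J1 (K J2 x) = K J3 x" for x
      using K2.trace_J[of x] H'(4)[OF tr] by (simp add: K_def)
    show "K J2 (K J1 x) = - K J3 x" for x
      using K1.trace_J[of x] H'(5)[OF tr] by (simp add: K_def minus_equation_iff)
  qed
  obtain b where b: "trace b = 0" "\<And>x. K2.koszul (K J2 x) = trace (b ** x)"
    "\<And>x. commutator b x = 0 \<Longrightarrow> trace x = 0 \<Longrightarrow>
       commutator b (K J1 x) = 0 \<and> commutator b (K J2 x) = 0 \<and> commutator b (K J3 x) = 0"
    using koszul_element by blast
  have "b \<noteq> 0"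
  proof
    assume "b = 0"
    have "K2.koszul x = 0" for x
    proof -
      have "K2.koszul x = K2.koszul (x - (trace x / 3) *\<^sub>R mat 1)"
        by (simp add: K2.koszul_def commutator_simps)
      \<comment> \<open>Every traceless matrix is an image under \<open>K J2\<close>, so the
        vanishing of \<beta> passes to the Koszul form itself.\<close>
      also have "x - (trace x / 3) *\<^sub>R mat 1 = K J2 (K J2 (- (x - (trace x / 3) *\<^sub>R mat 1)))"
        by (subst K2.J_J) (simp_all only: trace_minus tr minus_minus minus_zero)
      also have "K2.koszul \<dots> = 0"
        by (subst b(2)) (simp add: \<open>b = 0\<close>)
      finally show ?thesis .
    qed
    then show False
      using koszul_nonzero[OF K2.complex_structure_matrix_axioms] by blast
  qed
  then interpret hypercomplex_structure_matrix_3 "K J1" "K J2" "K J3" b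
    by unfold_locales (use b in auto)
  show False by (rule koszul_element_contradiction)
qed

section \<open>Tangent spaces of SL(3) and left-invariant vector fields\<close>

lemma frechet_derivative_on_tangent_space:
  assumes f: "(f has_derivative L) (at p within S)" and v: "v \<in> tangent_space S p"
  shows "frechet_derivative f (at p within S) v = L v"
proof -
  obtain \<gamma> where \<gamma>: "\<gamma> 0 = p" "\<forall>\<^sub>F t in nhds 0. \<gamma> t \<in> S" "(\<gamma> has_vector_derivative v) (at (0::real))"
    using v by (auto simp: tangent_space_def)
  then obtain U where U: "open U" "0 \<in> U" "\<And>t. t \<in> U \<Longrightarrow> \<gamma> t \<in> S"
    unfolding eventually_nhds by blast
  \<comment> \<open>Every derivative of f within S computes the same velocity of f along \<gamma>,
    so all of them agree at v.\<close>
  have chain: "((f \<circ> \<gamma>) has_vector_derivative L' v) (at 0)" if "(f has_derivative L') (at p within S)" for L'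
  proof -
    have "(f has_derivative L') (at (\<gamma> 0) within \<gamma> ` U)"
      using that U(3) \<gamma>(1) by (auto intro: has_derivative_subset)
    moreover have "(\<gamma> has_vector_derivative v) (at 0 within U)"
      by (rule has_vector_derivative_at_within) (rule \<gamma>(3))
    ultimately have "((f \<circ> \<gamma>) has_vector_derivative L' v) (at 0 within U)"
      by (intro vector_derivative_diff_chain_within)
    then show ?thesis
      using at_within_open[OF U(2,1)] by simp
  qed
  have "(f has_derivative frechet_derivative f (at p within S)) (at p within S)"
    using f by (auto simp: frechet_derivative_works[symmetric] differentiable_def)
  then show ?thesis
    using chain f vector_derivative_unique_at by blast
qed

lemma has_derivative_right_mult: "((\<lambda>q :: real^'n^'n. q ** (x :: real^'n^'n)) has_derivative (\<lambda>q. q ** x)) F"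
  using linear_matrix_mult_right[of x] by (intro bounded_linear_imp_has_derivative) (simp add: linear_conv_bounded_linear)

lemma Ck_on_open_const: "Ck_on_open k U (\<lambda>x. c)"
proof (induction k arbitrary: c)
  case (Suc k)
  have "frechet_derivative (\<lambda>x. c) (at x) = (\<lambda>_. 0)" for x :: 'a
    by (rule frechet_derivative_at[symmetric]) simp
  then show ?case using Suc by simp
qed simp

lemma Ck_on_open_right_mult: "Ck_on_open k U (\<lambda>q :: real^'n^'n. q ** (x :: real^'n^'n))"
proof (cases k)
  case 0
  then show ?thesis
    using has_derivative_continuous_on[OF has_derivative_right_mult] by simp
next
  case (Suc k)
  have "frechet_derivative (\<lambda>q. q ** x) (at q) = (\<lambda>q. q ** x)" for q :: "real^'n^'n"
    by (rule frechet_derivative_at[symmetric]) (rule has_derivative_right_mult)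
  then show ?thesis
    using has_derivative_right_mult Suc by (auto simp: differentiable_def Ck_on_open_const)
qed

lemma mat_1_in_SL3: "mat 1 \<in> SL3"
  by (simp add: SL3_def)

lemma has_field_derivative_entry:
  fixes f :: "real \<Rightarrow> real^'n^'m"
  assumes "(f has_vector_derivative v) F"
  shows "((\<lambda>t. f t $ i $ j) has_field_derivative v $ i $ j) F"
proof -
  have "bounded_linear (\<lambda>z :: real^'n^'m. z $ i $ j)"
    by (intro bounded_linear_compose[OF bounded_linear_vec_nth] bounded_linear_vec_nth)
  from bounded_linear.has_vector_derivative[OF this assms] show ?thesis
    by (simp add: has_real_derivative_iff_has_vector_derivative)
qed

lemma det_has_derivative_trace:
  fixes f :: "real \<Rightarrow> real^'n^'n"
  assumes "(f has_vector_derivative v) (at 0)" "f 0 = mat 1"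
  shows "((\<lambda>t. det (f t)) has_field_derivative trace v) (at 0)"
proof -
  have "((\<lambda>t. det (f t)) has_field_derivative (\<Sum>i\<in>UNIV. det (\<chi> k. if k = i then v $ k else f 0 $ k))) (at 0)"
    by (intro det_has_field_derivative has_field_derivative_entry assms)
  then show ?thesis
    using sum_det_row_replaced[of v "mat 1"] by (simp only: assms(2) matrix_mul_rid det_I mult_1_right)
qed

lemma left_translate_in_tangent_space_SL3:
  assumes A: "A \<in> SL3" and x: "x \<in> sl3"
  shows "A ** x \<in> tangent_space SL3 A"
proof -
  define f :: "real \<Rightarrow> real^3^3" where "f t = mat 1 + t *\<^sub>R x" for t
  have f0: "f 0 = mat 1" by (simp add: f_def)
  have f: "(f has_vector_derivative x) (at 0)"
    unfolding f_def has_vector_derivative_def by (auto intro!: derivative_eq_intros)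
  have d: "((\<lambda>t. det (f t)) has_field_derivative 0) (at 0)"
    using det_has_derivative_trace[OF f f0] x by (simp add: sl3_def)
  \<comment> \<open>Dividing the first row of 1 + t x by the determinant puts the curve into the
    group. The determinant has derivative tr x = 0 at t = 0, so the velocity is still x.\<close>
  define c :: "real \<Rightarrow> real^3^3" where "c t = (\<chi> i. if i = 1 then inverse (det (f t)) *s f t $ i else f t $ i)" for t
  have det_c: "det (c t) = 1" if "det (f t) \<noteq> 0" for t
  proof -
    have "c t = (\<chi> i. if i = 1 then inverse (det (f t)) *s f t $ 1 else f t $ i)"
      by (auto simp: c_def vec_eq_iff)
    moreover have "(\<chi> i. if i = 1 then f t $ 1 else f t $ i) = f t"
      by (auto simp: vec_eq_iff)
    ultimately show ?thesis
      using that det_row_mul[of 1 "inverse (det (f t))" "\<lambda>_. f t $ 1" "\<lambda>i. f t $ i"] by simp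
  qed
  have c: "(c has_vector_derivative x) (at 0)"
  proof (intro has_vector_derivative_vecI)
    fix i j
    have entry: "((\<lambda>t. f t $ i $ j) has_field_derivative x $ i $ j) (at 0)"
      by (rule has_field_derivative_entry[OF f])
    have "((\<lambda>t. inverse (det (f t))) has_field_derivative 0) (at 0)"
      using DERIV_inverse_fun[OF d] by (simp add: f0)
    from DERIV_mult[OF this entry] have "((\<lambda>t. inverse (det (f t)) * f t $ i $ j) has_field_derivative x $ i $ j) (at 0)"
      by (simp add: f0)
    with entry show "((\<lambda>t. c t $ i $ j) has_vector_derivative x $ i $ j) (at 0)"
      by (cases "i = 1") (simp_all add: c_def has_real_derivative_iff_has_vector_derivative)
  qed
  have "((\<lambda>t. det (f t)) \<longlongrightarrow> det (f 0)) (at 0)"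
    using DERIV_isCont[OF d] by (simp add: isCont_def)
  then have "\<forall>\<^sub>F t in at 0. det (f t) \<noteq> 0"
    by (rule tendsto_imp_eventually_ne) (simp add: f0)
  then have "\<forall>\<^sub>F t in nhds 0. det (f t) \<noteq> 0"
    by (simp add: eventually_nhds_conv_at f0)
  then have "\<forall>\<^sub>F t in nhds 0. A ** c t \<in> SL3"
    by eventually_elim (use A in \<open>simp add: SL3_def det_mul det_c\<close>)
  moreover have "A ** c 0 = A"
  proof -
    have "c 0 = mat 1" by (simp add: c_def f0 vec_eq_iff)
    then show ?thesis by simp
  qed
  moreover have "((\<lambda>t. A ** c t) has_vector_derivative A ** x) (at 0)"
    using linear_matrix_mult_left[of A] c
    by (intro bounded_linear.has_vector_derivative[of "(**) A"]) (simp_all add: linear_conv_bounded_linear)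
  ultimately show ?thesis
    unfolding tangent_space_def by (intro CollectI exI[of _ "\<lambda>t. A ** c t"]) simp
qed

lemma tangent_space_SL3_mat_1: "tangent_space SL3 (mat 1) = sl3"
proof
  show "sl3 \<subseteq> tangent_space SL3 (mat 1)"
    using left_translate_in_tangent_space_SL3[OF mat_1_in_SL3] by auto
  show "tangent_space SL3 (mat 1) \<subseteq> sl3"
  proof
    fix v assume "v \<in> tangent_space SL3 (mat 1)"
    then obtain \<gamma> :: "real \<Rightarrow> real^3^3" where \<gamma>: "\<gamma> 0 = mat 1" "\<forall>\<^sub>F t in nhds 0. \<gamma> t \<in> SL3" "(\<gamma> has_vector_derivative v) (at 0)"
      by (auto simp: tangent_space_def)
    have "((\<lambda>t. det (\<gamma> t)) has_field_derivative trace v) (at 0)"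
      by (rule det_has_derivative_trace[OF \<gamma>(3,1)])
    moreover have "\<forall>\<^sub>F t in nhds 0. det (\<gamma> t) = 1"
      using \<gamma>(2) by eventually_elim (simp add: SL3_def)
    ultimately have "((\<lambda>t. 1) has_field_derivative trace v) (at (0::real))"
      using DERIV_cong_ev[of 0 0 "\<lambda>t. det (\<gamma> t)" "\<lambda>t. 1"] by simp
    then have "trace v = 0"
      using DERIV_unique DERIV_const by blast
    then show "v \<in> sl3" by (simp add: sl3_def)
  qed
qed

text \<open>X and Y are prescribed only on the group, as a field such as q -> J q (q x) is known
  only there. On tangent vectors at the identity the derivative of q -> q y is right multiplication
  by y, which yields x y - y x.\<close>

lemma vf_bracket_left_invariant:
  assumes X: "\<And>q. q \<in> SL3 \<Longrightarrow> X q = q ** x" and Y: "\<And>q. q \<in> SL3 \<Longrightarrow> Y q = q ** y"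
    and xy: "x \<in> sl3" "y \<in> sl3"
  shows "vf_bracket SL3 X Y (mat 1) = commutator x y"
proof -
  have deriv: "frechet_derivative Z (at (mat 1) within SL3) v = v ** z"
    if "\<And>q. q \<in> SL3 \<Longrightarrow> Z q = q ** z" "v \<in> sl3" for Z v and z :: "real^3^3"
  proof -
    have "(Z has_derivative (\<lambda>q. q ** z)) (at (mat 1) within SL3)"
      by (rule has_derivative_transform[where f="\<lambda>q. q ** z"]) (use that in \<open>auto simp: mat_1_in_SL3 has_derivative_right_mult\<close>)
    from frechet_derivative_on_tangent_space[OF this] show ?thesis
      using that(2) by (simp add: tangent_space_SL3_mat_1)
  qed
  show ?thesis
    using deriv[OF X xy(2)] deriv[OF Y xy(1)] X[OF mat_1_in_SL3] Y[OF mat_1_in_SL3]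
    by (simp add: vf_bracket_def commutator_def)
qed

text \<open>By invariance J sends the left-invariant field of x to that of J(1) x, so at the
  identity the brackets in the Nijenhuis tensor of fields become commutators.\<close>

lemma complex_structure_at_mat_1:
  assumes J: "manifold_complex_structure SL3 J" and inv: "left_invariant SL3 J"
  shows "complex_structure_on sl3 commutator (J (mat 1))"
proof -
  let ?j = "J (mat 1)"
  have endo: "linear_endo_on sl3 ?j" "\<And>x. x \<in> sl3 \<Longrightarrow> ?j (?j x) = - x"
    using J mat_1_in_SL3 by (auto simp: manifold_complex_structure_def tangent_space_SL3_mat_1[symmetric])
  then have j: "?j x \<in> sl3" if "x \<in> sl3" for x
    using that by (simp add: linear_endo_on_def)
  have field: "J q (q ** x) = q ** ?j x" if "q \<in> SL3" "x \<in> sl3" for q x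
    using inv that mat_1_in_SL3 unfolding left_invariant_def
    by (metis matrix_mul_rid tangent_space_SL3_mat_1)
  have smooth: "smooth_vector_field SL3 (\<lambda>q. q ** x)" if "x \<in> sl3" for x
    unfolding smooth_vector_field_def smooth_map_on_def
    using left_translate_in_tangent_space_SL3[OF _ that] Ck_on_open_right_mult[of _ UNIV x]
    by (metis UNIV_I open_UNIV)
  have "nijenhuis commutator ?j x y = 0" if xy: "x \<in> sl3" "y \<in> sl3" for x y
  proof -
    have "vf_nijenhuis SL3 J (\<lambda>q. q ** x) (\<lambda>q. q ** y) (mat 1) = 0"
      using J smooth xy mat_1_in_SL3 by (auto simp: manifold_complex_structure_def)
    then show ?thesis
      using xy j field vf_bracket_left_invariant[of "\<lambda>q. q ** x" x "\<lambda>q. q ** y" y]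
        vf_bracket_left_invariant[of "\<lambda>q. J q (q ** x)" "?j x" "\<lambda>q. q ** y" y]
        vf_bracket_left_invariant[of "\<lambda>q. q ** x" x "\<lambda>q. J q (q ** y)" "?j y"]
        vf_bracket_left_invariant[of "\<lambda>q. J q (q ** x)" "?j x" "\<lambda>q. J q (q ** y)" "?j y"]
      by (simp add: vf_nijenhuis_def Let_def nijenhuis_def)
  qed
  then show ?thesis
    using endo by (simp add: complex_structure_on_def)
qed

theorem theorem3p4:
  shows "(\<nexists>J1 J2 J3.
            manifold_hypercomplex_structure SL3 J1 J2 J3 \<and>
            left_invariant SL3 J1 \<and> left_invariant SL3 J2 \<and> left_invariant SL3 J3) \<and>
         (\<nexists>J1 J2 J3. hypercomplex_structure_on sl3 commutator J1 J2 J3)"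
proof -
  have "hypercomplex_structure_on sl3 commutator (J1 (mat 1)) (J2 (mat 1)) (J3 (mat 1))"
    if "manifold_hypercomplex_structure SL3 J1 J2 J3"
      "left_invariant SL3 J1" "left_invariant SL3 J2" "left_invariant SL3 J3" for J1 J2 J3
    using that complex_structure_at_mat_1 mat_1_in_SL3
    by (simp add: manifold_hypercomplex_structure_def hypercomplex_structure_on_def tangent_space_SL3_mat_1)
  then show ?thesis
    using no_hypercomplex_structure_sl3 by blast
qed

end
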